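(* Let $\alpha\in\mathbb C$ with $\alpha\ne0$ and $\frac1\alpha\notin\mathbb Z$, and let $L(\lambda)$ be an irreducible highest weight module for $S(1,2,\alpha)$, with $\lambda_i=\lambda(h_i)$. If $\lambda_2\ne0$ or $\lambda_3\neq0$, then $L(\lambda)$ is integrable if and only if $\lambda_1\in\mathbb Z_{\ge0}$ and $\lambda_2+\lambda_3-1\in\mathbb Z_{\ge0}$. If $\lambda_2=\lambda_3=0$, then $L(\lambda)$ is integrable if and only if $\lambda_1\in\mathbb Z_{\ge0}$.
   Context: $S(1,2,\alpha)$ is the contragredient Lie superalgebra $\mathfrak g(B)$ with $$B=(b_{ij})=\begin{pmatrix}2&-1&-1\\-1+\alpha&0&1\\-1-\alpha&1&0\end{pmatrix},\qquad p(1)=0,\ p(2)=p(3)=1.$$ Here, for an $n\times n$ matrix $A$ with parity function $p$: $\mathfrak h$ has dimension $2n-\operatorname{rk}A$ with linearly independent $\alpha_i\in\mathfrak h^*$ and linearly independent $h_i\in\mathfrak h$, $\alpha_j(h_i)=a_{ij}$; $\mathfrak g(A)$ is generated by $\mathfrak h$ (even) and $X_i,Y_i$ of parity $p(i)$ with relations $[h,h']=0$, $[h,X_i]=\alpha_i(h)X_i$, $[h,Y_i]=-\alpha_i(h)Y_i$, $[X_i,Y_j]=\delta_{ij}h_i$, modulo the unique maximal ideal intersecting $\mathfrak h$ trivially. $\mathfrak n_+$ is the subalgebra generated by the $X_i$. $L(\lambda)$ is the irreducible module generated by a vector $v_\lambda\neq 0$ with $\mathfrak n_+v_\lambda=0$,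 $hv_\lambda=\lambda(h)v_\lambda$ for $h\in\mathfrak h$. A root $\beta$ is real if $\beta$ or $\frac12\beta$ is simple in some base obtained from $\{\alpha_1,\alpha_2,\alpha_3\}$ by a sequence of even reflections (at a simple $\alpha_k$ with $a_{kk}\ne0$, rescaled to $a_{kk}=2$: $\alpha_i\mapsto\alpha_i-\alpha_i(h_k)\alpha_k$) and odd reflections (at a simple odd $\alpha_k$ with $a_{kk}=0$: $\alpha_k\mapsto-\alpha_k$, and for $i\ne k$, $\alpha_i\mapsto\alpha_i+\alpha_k$ if $a_{ik}\ne0$ or $a_{ki}\neq0$, $\alpha_i\mapsto\alpha_i$ otherwise), where each new base is given the corresponding Cartan matrix. A weight module is integrable if for every real root $\beta$ the elements of the root space $\mathfrak g_\beta$ act locally nilpotently. *)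

theory Defs
  imports "HOL-Analysis.Analysis" "HOL-Library.Poly_Mapping" "HOL-Library.Z2"
begin

text \<open>
  Superspaces are complex vector spaces with a grading \<open>gr\<close> by \<open>bit\<close>, the field with two
  elements: \<open>gr 0\<close> is the even part and \<open>gr 1\<close> the odd part.
\<close>

locale super_space = vector_space sc
  for sc :: "complex \<Rightarrow> 'v::ab_group_add \<Rightarrow> 'v" +
  fixes gr :: "bit \<Rightarrow> 'v set"
  assumes gr_subspace: "subspace (gr a)"
    and gr_sum: "\<exists>x\<in>gr 0. \<exists>y\<in>gr 1. v = x + y"
    and gr_direct: "gr 0 \<inter> gr 1 = {0}"

definition super_sign :: "bit \<Rightarrow> bit \<Rightarrow> complex" where
  "super_sign a b = (if a = 1 \<and> b = 1 then - 1 else 1)"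

locale lie_superalgebra = super_space sc gr
  for sc :: "complex \<Rightarrow> 'g::ab_group_add \<Rightarrow> 'g" and gr :: "bit \<Rightarrow> 'g set" +
  fixes br :: "'g \<Rightarrow> 'g \<Rightarrow> 'g"
  assumes br_linear_right: "Vector_Spaces.linear sc sc (br x)"
    and br_linear_left: "Vector_Spaces.linear sc sc (\<lambda>x. br x y)"
    and br_graded: "\<lbrakk>x \<in> gr a; y \<in> gr b\<rbrakk> \<Longrightarrow> br x y \<in> gr (a + b)"
    and br_super_antisym:
      "\<lbrakk>x \<in> gr a; y \<in> gr b\<rbrakk> \<Longrightarrow> br x y = - sc (super_sign a b) (br y x)"
    and br_super_jacobi:
      "\<lbrakk>x \<in> gr a; y \<in> gr b; z \<in> gr c\<rbrakk> \<Longrightarrow>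
        br x (br y z) = br (br x y) z + sc (super_sign a b) (br y (br x z))"

locale lie_supermodule =
  lie_superalgebra gscale ggr br + V: super_space vscale vgr
  for gscale :: "complex \<Rightarrow> 'g::ab_group_add \<Rightarrow> 'g" and ggr :: "bit \<Rightarrow> 'g set"
    and br :: "'g \<Rightarrow> 'g \<Rightarrow> 'g"
    and vscale :: "complex \<Rightarrow> 'v::ab_group_add \<Rightarrow> 'v" and vgr :: "bit \<Rightarrow> 'v set" +
  fixes act :: "'g \<Rightarrow> 'v \<Rightarrow> 'v"
  assumes act_linear_right: "Vector_Spaces.linear vscale vscale (act x)"
    and act_linear_left: "Vector_Spaces.linear gscale vscale (\<lambda>x. act x v)"
    and act_graded: "\<lbrakk>x \<in> ggr a; v \<in> vgr b\<rbrakk> \<Longrightarrow> act x v \<in> vgr (a + b)"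
    and act_br:
      "\<lbrakk>x \<in> ggr a; y \<in> ggr b\<rbrakk> \<Longrightarrow>
        act (br x y) v = act x (act y v) - vscale (super_sign a b) (act y (act x v))"

definition graded_subspace ::
  "(complex \<Rightarrow> 'v::ab_group_add \<Rightarrow> 'v) \<Rightarrow> (bit \<Rightarrow> 'v set) \<Rightarrow> 'v set \<Rightarrow> bool" where
  "graded_subspace sc gr U \<longleftrightarrow>
     module.subspace sc U \<and> (\<forall>u\<in>U. \<exists>x\<in>U \<inter> gr 0. \<exists>y\<in>U \<inter> gr 1. u = x + y)"

definition super_ideal ::
  "(complex \<Rightarrow> 'g::ab_group_add \<Rightarrow> 'g) \<Rightarrow> (bit \<Rightarrow> 'g set) \<Rightarrow> ('g \<Rightarrow> 'g \<Rightarrow> 'g) \<Rightarrow> 'g set \<Rightarrow> bool" where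
  "super_ideal sc gr br J \<longleftrightarrow>
     graded_subspace sc gr J \<and> (\<forall>x\<in>J. \<forall>y. br x y \<in> J \<and> br y x \<in> J)"

definition generated_subalgebra ::
  "(complex \<Rightarrow> 'g::ab_group_add \<Rightarrow> 'g) \<Rightarrow> ('g \<Rightarrow> 'g \<Rightarrow> 'g) \<Rightarrow> 'g set \<Rightarrow> 'g set" where
  "generated_subalgebra sc br S =
     \<Inter>{U. module.subspace sc U \<and> (\<forall>x\<in>U. \<forall>y\<in>U. br x y \<in> U) \<and> S \<subseteq> U}"

definition submodule ::
  "(complex \<Rightarrow> 'v::ab_group_add \<Rightarrow> 'v) \<Rightarrow> (bit \<Rightarrow> 'v set) \<Rightarrow> ('g \<Rightarrow> 'v \<Rightarrow> 'v) \<Rightarrow> 'v set \<Rightarrow> bool" where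
  "submodule vscale vgr act W \<longleftrightarrow>
     graded_subspace vscale vgr W \<and> (\<forall>x. \<forall>w\<in>W. act x w \<in> W)"

section \<open>Generators and relations\<close>

text \<open>
  A presented Lie superalgebra is a quotient of the free nonassociative algebra on the
  generators.  The basis of the latter consists of the nonassociative words (\<open>magma\<close>), and
  its elements are finitely supported coefficient functions on words.
\<close>

datatype 'x magma = Gen 'x | Br "'x magma" "'x magma"

type_synonym 'x free_alg = "'x magma \<Rightarrow>\<^sub>0 complex"

definition free_scale :: "complex \<Rightarrow> 'x free_alg \<Rightarrow> 'x free_alg" where
  "free_scale c f = Poly_Mapping.map ((*) c) f"

definition free_br :: "'x free_alg \<Rightarrow> 'x free_alg \<Rightarrow> 'x free_alg" where
  "free_br f g = (\<Sum>s\<in>Poly_Mapping.keys f. \<Sum>t\<in>Poly_Mapping.keys g.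
     Poly_Mapping.single (Br s t) (Poly_Mapping.lookup f s * Poly_Mapping.lookup g t))"

definition free_gen :: "'x \<Rightarrow> 'x free_alg" where
  "free_gen x = Poly_Mapping.single (Gen x) 1"

primrec magma_parity :: "('x \<Rightarrow> bit) \<Rightarrow> 'x magma \<Rightarrow> bit" where
  "magma_parity par (Gen x) = par x"
| "magma_parity par (Br s t) = magma_parity par s + magma_parity par t"

definition free_gr :: "('x \<Rightarrow> bit) \<Rightarrow> bit \<Rightarrow> 'x free_alg set" where
  "free_gr par a = {f. \<forall>t\<in>Poly_Mapping.keys f. magma_parity par t = a}"

primrec magma_eval :: "('g \<Rightarrow> 'g \<Rightarrow> 'g) \<Rightarrow> ('x \<Rightarrow> 'g) \<Rightarrow> 'x magma \<Rightarrow> 'g" where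
  "magma_eval br e (Gen x) = e x"
| "magma_eval br e (Br s t) = br (magma_eval br e s) (magma_eval br e t)"

definition free_eval ::
  "(complex \<Rightarrow> 'g::ab_group_add \<Rightarrow> 'g) \<Rightarrow> ('g \<Rightarrow> 'g \<Rightarrow> 'g) \<Rightarrow> ('x \<Rightarrow> 'g) \<Rightarrow> 'x free_alg \<Rightarrow> 'g" where
  "free_eval sc br e f =
     (\<Sum>t\<in>Poly_Mapping.keys f. sc (Poly_Mapping.lookup f t) (magma_eval br e t))"

lemma vector_space_free_scale: "vector_space free_scale"
proof -
  have [simp]: "Poly_Mapping.lookup (free_scale c f) t = c * Poly_Mapping.lookup f t"
    for c and f :: "'x free_alg" and t
    by (simp add: free_scale_def Poly_Mapping.map.rep_eq when_def)
  show ?thesis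
    by unfold_locales (auto intro!: poly_mapping_eqI simp: lookup_add algebra_simps)
qed

text \<open>The generators are all elements of the Cartan subalgebra \<open>'h\<close>, together with \<open>X\<^sub>i\<close>, \<open>Y\<^sub>i\<close>.\<close>

datatype ('h, 'n) chev_gen = GH 'h | GX 'n | GY 'n

primrec chev_parity :: "('n \<Rightarrow> bit) \<Rightarrow> ('h, 'n) chev_gen \<Rightarrow> bit" where
  "chev_parity p (GH h) = 0"
| "chev_parity p (GX i) = p i"
| "chev_parity p (GY i) = p i"

primrec chev_image ::
  "('h \<Rightarrow> 'g) \<Rightarrow> ('n \<Rightarrow> 'g) \<Rightarrow> ('n \<Rightarrow> 'g) \<Rightarrow> ('h, 'n) chev_gen \<Rightarrow> 'g" where
  "chev_image H X Y (GH h) = H h"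
| "chev_image H X Y (GX i) = X i"
| "chev_image H X Y (GY i) = Y i"

text \<open>
  The first two families are the Lie superalgebra axioms, the next two make \<open>GH\<close> linear;
  the others are the relations between the generators.
\<close>

inductive_set chev_relations ::
  "(complex \<Rightarrow> 'h::ab_group_add \<Rightarrow> 'h) \<Rightarrow> ('n \<Rightarrow> 'h) \<Rightarrow> ('n \<Rightarrow> 'h \<Rightarrow> complex) \<Rightarrow> ('n \<Rightarrow> bit) \<Rightarrow>
   ('h, 'n) chev_gen free_alg set"
  for hscale :: "complex \<Rightarrow> 'h::ab_group_add \<Rightarrow> 'h" and hc :: "'n \<Rightarrow> 'h"
    and rt :: "'n \<Rightarrow> 'h \<Rightarrow> complex" and p :: "'n \<Rightarrow> bit" where
  antisym: "\<lbrakk>u \<in> free_gr (chev_parity p) a; v \<in> free_gr (chev_parity p) b\<rbrakk> \<Longrightarrow>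
    free_br u v + free_scale (super_sign a b) (free_br v u) \<in> chev_relations hscale hc rt p"
| jacobi: "\<lbrakk>u \<in> free_gr (chev_parity p) a; v \<in> free_gr (chev_parity p) b;
            w \<in> free_gr (chev_parity p) c\<rbrakk> \<Longrightarrow>
    free_br u (free_br v w) - free_br (free_br u v) w
      - free_scale (super_sign a b) (free_br v (free_br u w)) \<in> chev_relations hscale hc rt p"
| H_add: "free_gen (GH (h + h')) - free_gen (GH h) - free_gen (GH h')
    \<in> chev_relations hscale hc rt p"
| H_scale: "free_gen (GH (hscale c h)) - free_scale c (free_gen (GH h))
    \<in> chev_relations hscale hc rt p"
| H_H: "free_br (free_gen (GH h)) (free_gen (GH h')) \<in> chev_relations hscale hc rt p"
| H_X: "free_br (free_gen (GH h)) (free_gen (GX i)) - free_scale (rt i h) (free_gen (GX i))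
    \<in> chev_relations hscale hc rt p"
| H_Y: "free_br (free_gen (GH h)) (free_gen (GY i)) + free_scale (rt i h) (free_gen (GY i))
    \<in> chev_relations hscale hc rt p"
| X_Y_same: "free_br (free_gen (GX i)) (free_gen (GY i)) - free_gen (GH (hc i))
    \<in> chev_relations hscale hc rt p"
| X_Y_diff: "i \<noteq> j \<Longrightarrow> free_br (free_gen (GX i)) (free_gen (GY j)) \<in> chev_relations hscale hc rt p"

text \<open>
  The quotient of the free algebra by \<open>chev_ideal\<close> is the Lie superalgebra presented by these
  relations.
\<close>

definition chev_ideal ::
  "(complex \<Rightarrow> 'h::ab_group_add \<Rightarrow> 'h) \<Rightarrow> ('n \<Rightarrow> 'h) \<Rightarrow> ('n \<Rightarrow> 'h \<Rightarrow> complex) \<Rightarrow> ('n \<Rightarrow> bit) \<Rightarrow>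
   ('h, 'n) chev_gen free_alg set" where
  "chev_ideal hscale hc rt p =
     \<Inter>{J. super_ideal free_scale (free_gr (chev_parity p)) free_br J
           \<and> chev_relations hscale hc rt p \<subseteq> J}"

text \<open>
  Ideals of that presented Lie superalgebra whose intersection with (the image of) the Cartan
  subalgebra is zero, given by their preimages in the free algebra.
\<close>

definition cartan_free_ideals ::
  "(complex \<Rightarrow> 'h::ab_group_add \<Rightarrow> 'h) \<Rightarrow> ('n \<Rightarrow> 'h) \<Rightarrow> ('n \<Rightarrow> 'h \<Rightarrow> complex) \<Rightarrow> ('n \<Rightarrow> bit) \<Rightarrow>
   ('h, 'n) chev_gen free_alg set set" where
  "cartan_free_ideals hscale hc rt p =
     {J. super_ideal free_scale (free_gr (chev_parity p)) free_br J
         \<and> chev_ideal hscale hc rt p \<subseteq> J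
         \<and> (\<forall>h. free_gen (GH h) \<in> J \<longrightarrow> free_gen (GH h) \<in> chev_ideal hscale hc rt p)}"

section \<open>Contragredient Lie superalgebras\<close>

text \<open>\<open>'h\<close> is the Cartan subalgebra, \<open>hc i\<close> is \<open>h\<^sub>i\<close> and \<open>rt i\<close> is \<open>\<alpha>\<^sub>i\<close>.\<close>

locale realization = vector_space hscale
  for hscale :: "complex \<Rightarrow> 'h::ab_group_add \<Rightarrow> 'h" +
  fixes A :: "complex ^ 'n ^ 'n"
    and hc :: "'n::finite \<Rightarrow> 'h"
    and rt :: "'n \<Rightarrow> 'h \<Rightarrow> complex"
  assumes h_dim: "\<exists>B. finite B \<and> independent B \<and> span B = UNIV \<and> card B = 2 * CARD('n) - rank A"
    and rt_linear: "Vector_Spaces.linear hscale (*) (rt i)"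
    and rt_independent: "(\<And>h. (\<Sum>i\<in>UNIV. c i * rt i h) = 0) \<Longrightarrow> c i = 0"
    and hc_independent: "(\<Sum>i\<in>UNIV. hscale (c i) (hc i)) = 0 \<Longrightarrow> c i = 0"
    and rt_hc: "rt j (hc i) = A $ i $ j"

text \<open>
  \<open>gscale\<close>, \<open>gr\<close>, \<open>br\<close> is a Lie superalgebra which, through the evaluation of words, is the
  quotient of the presented Lie superalgebra by its largest ideal meeting the Cartan subalgebra
  trivially. \<open>H\<close> is the resulting map from the Cartan subalgebra.
\<close>

locale contragredient =
  realization hscale A hc rt + g: lie_superalgebra gscale gr br
  for hscale :: "complex \<Rightarrow> 'h::ab_group_add \<Rightarrow> 'h"
    and A :: "complex ^ 'n ^ 'n"
    and hc :: "'n::finite \<Rightarrow> 'h"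
    and rt :: "'n \<Rightarrow> 'h \<Rightarrow> complex"
    and gscale :: "complex \<Rightarrow> 'g::ab_group_add \<Rightarrow> 'g"
    and gr :: "bit \<Rightarrow> 'g set"
    and br :: "'g \<Rightarrow> 'g \<Rightarrow> 'g" +
  fixes p :: "'n \<Rightarrow> bit" and H :: "'h \<Rightarrow> 'g" and X Y :: "'n \<Rightarrow> 'g"
  assumes gens_graded: "chev_image H X Y x \<in> gr (chev_parity p x)"
    and eval_surj: "range (free_eval gscale br (chev_image H X Y)) = UNIV"
    and eval_kernel_mem:
      "{f. free_eval gscale br (chev_image H X Y) f = 0} \<in> cartan_free_ideals hscale hc rt p"
    and eval_kernel_greatest:
      "J \<in> cartan_free_ideals hscale hc rt p \<Longrightarrow>
        J \<subseteq> {f. free_eval gscale br (chev_image H X Y) f = 0}"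

definition S12_matrix :: "complex \<Rightarrow> complex ^ 3 ^ 3" where
  "S12_matrix \<alpha> = vector [vector [2, - 1, - 1],
                            vector [- 1 + \<alpha>, 0, 1],
                            vector [- 1 - \<alpha>, 1, 0]]"

definition S12_parity :: "3 \<Rightarrow> bit" where
  "S12_parity i = (if i = 1 then 0 else 1)"

section \<open>Real roots\<close>

definition root_space ::
  "(complex \<Rightarrow> 'g \<Rightarrow> 'g) \<Rightarrow> ('g \<Rightarrow> 'g \<Rightarrow> 'g) \<Rightarrow> ('h \<Rightarrow> 'g) \<Rightarrow> ('h \<Rightarrow> complex) \<Rightarrow> 'g set" where
  "root_space gscale br H \<beta> = {x. \<forall>h. br (H h) x = gscale (\<beta> h) x}"

definition is_root ::
  "(complex \<Rightarrow> 'g::ab_group_add \<Rightarrow> 'g) \<Rightarrow> ('g \<Rightarrow> 'g \<Rightarrow> 'g) \<Rightarrow> ('h \<Rightarrow> 'g) \<Rightarrow> ('h \<Rightarrow> complex) \<Rightarrow> bool" where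
  "is_root gscale br H \<beta> \<longleftrightarrow> (\<exists>h. \<beta> h \<noteq> 0) \<and> root_space gscale br H \<beta> \<noteq> {0}"

text \<open>
  The Cartan matrix of a base \<open>a\<close> has entries \<open>a j (h i)\<close>, where \<open>h i\<close> is the bracket of root
  vectors of roots \<open>a i\<close> and \<open>- a i\<close> which form, with the Cartan subalgebra, a system of
  Chevalley generators.  It is determined up to nonzero multiples of its rows; \<open>q\<close> records the
  parities of the simple roots.
\<close>

definition base_datum ::
  "(complex \<Rightarrow> 'g::ab_group_add \<Rightarrow> 'g) \<Rightarrow> (bit \<Rightarrow> 'g set) \<Rightarrow> ('g \<Rightarrow> 'g \<Rightarrow> 'g) \<Rightarrow> ('h \<Rightarrow> 'g) \<Rightarrow>
   ('n \<Rightarrow> bit) \<Rightarrow> ('n \<Rightarrow> 'h) \<Rightarrow> ('n \<Rightarrow> 'h \<Rightarrow> complex) \<Rightarrow> bool" where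
  "base_datum gscale gr br H q h a \<longleftrightarrow>
     (\<exists>X Y.
        (\<forall>i. X i \<in> root_space gscale br H (a i) \<inter> gr (q i)) \<and>
        (\<forall>i. Y i \<in> root_space gscale br H (\<lambda>x. - a i x) \<inter> gr (q i)) \<and>
        (\<forall>i j. br (X i) (Y j) = (if i = j then H (h i) else 0)) \<and>
        generated_subalgebra gscale br (range H \<union> range X \<union> range Y) = UNIV)"

text \<open>
  The factor \<open>2 / a k (h k)\<close> rescales \<open>h k\<close> so that the diagonal entry becomes 2.  The
  conditions in the odd reflection do not depend on the scaling.
\<close>

definition even_reflection ::
  "('n \<Rightarrow> 'h) \<Rightarrow> ('n \<Rightarrow> 'h \<Rightarrow> complex) \<Rightarrow> 'n \<Rightarrow> 'n \<Rightarrow> 'h \<Rightarrow> complex" where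
  "even_reflection h a k = (\<lambda>i x. a i x - (2 * a i (h k) / a k (h k)) * a k x)"

definition odd_reflection ::
  "('n \<Rightarrow> 'h) \<Rightarrow> ('n \<Rightarrow> 'h \<Rightarrow> complex) \<Rightarrow> 'n \<Rightarrow> 'n \<Rightarrow> 'h \<Rightarrow> complex" where
  "odd_reflection h a k = (\<lambda>i x.
     if i = k then - a k x
     else if a k (h i) \<noteq> 0 \<or> a i (h k) \<noteq> 0 then a i x + a k x
     else a i x)"

inductive reflected_base ::
  "(complex \<Rightarrow> 'g::ab_group_add \<Rightarrow> 'g) \<Rightarrow> (bit \<Rightarrow> 'g set) \<Rightarrow> ('g \<Rightarrow> 'g \<Rightarrow> 'g) \<Rightarrow> ('h \<Rightarrow> 'g) \<Rightarrow>
   ('n \<Rightarrow> bit) \<Rightarrow> ('n \<Rightarrow> 'h) \<Rightarrow> ('n \<Rightarrow> 'h \<Rightarrow> complex) \<Rightarrow>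
   ('n \<Rightarrow> bit) \<Rightarrow> ('n \<Rightarrow> 'h) \<Rightarrow> ('n \<Rightarrow> 'h \<Rightarrow> complex) \<Rightarrow> bool"
  for gscale :: "complex \<Rightarrow> 'g::ab_group_add \<Rightarrow> 'g" and gr :: "bit \<Rightarrow> 'g set"
    and br :: "'g \<Rightarrow> 'g \<Rightarrow> 'g" and H :: "'h \<Rightarrow> 'g"
    and p :: "'n \<Rightarrow> bit" and hc :: "'n \<Rightarrow> 'h" and rt :: "'n \<Rightarrow> 'h \<Rightarrow> complex" where
  initial: "reflected_base gscale gr br H p hc rt p hc rt"
| even: "\<lbrakk>reflected_base gscale gr br H p hc rt q h a; a k (h k) \<noteq> 0;
          base_datum gscale gr br H q' h' (even_reflection h a k)\<rbrakk> \<Longrightarrow>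
    reflected_base gscale gr br H p hc rt q' h' (even_reflection h a k)"
| odd: "\<lbrakk>reflected_base gscale gr br H p hc rt q h a; q k = 1; a k (h k) = 0;
         base_datum gscale gr br H q' h' (odd_reflection h a k)\<rbrakk> \<Longrightarrow>
    reflected_base gscale gr br H p hc rt q' h' (odd_reflection h a k)"

definition real_root ::
  "(complex \<Rightarrow> 'g::ab_group_add \<Rightarrow> 'g) \<Rightarrow> (bit \<Rightarrow> 'g set) \<Rightarrow> ('g \<Rightarrow> 'g \<Rightarrow> 'g) \<Rightarrow> ('h \<Rightarrow> 'g) \<Rightarrow>
   ('n \<Rightarrow> bit) \<Rightarrow> ('n \<Rightarrow> 'h) \<Rightarrow> ('n \<Rightarrow> 'h \<Rightarrow> complex) \<Rightarrow> ('h \<Rightarrow> complex) \<Rightarrow> bool" where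
  "real_root gscale gr br H p hc rt \<beta> \<longleftrightarrow>
     is_root gscale br H \<beta> \<and>
     (\<exists>q h a i. reflected_base gscale gr br H p hc rt q h a \<and>
        (\<beta> = a i \<or> (\<lambda>x. \<beta> x / 2) = a i))"

section \<open>Modules\<close>

definition weight_space ::
  "('h \<Rightarrow> 'g) \<Rightarrow> (complex \<Rightarrow> 'v \<Rightarrow> 'v) \<Rightarrow> ('g \<Rightarrow> 'v \<Rightarrow> 'v) \<Rightarrow> ('h \<Rightarrow> complex) \<Rightarrow> 'v set" where
  "weight_space H vscale act \<mu> = {v. \<forall>h. act (H h) v = vscale (\<mu> h) v}"

definition weight_module ::
  "('h \<Rightarrow> 'g) \<Rightarrow> (complex \<Rightarrow> 'v::ab_group_add \<Rightarrow> 'v) \<Rightarrow> ('g \<Rightarrow> 'v \<Rightarrow> 'v) \<Rightarrow> bool" where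
  "weight_module H vscale act \<longleftrightarrow>
     module.span vscale (\<Union>\<mu>. weight_space H vscale act \<mu>) = UNIV"

definition integrable_module ::
  "(complex \<Rightarrow> 'g::ab_group_add \<Rightarrow> 'g) \<Rightarrow> (bit \<Rightarrow> 'g set) \<Rightarrow> ('g \<Rightarrow> 'g \<Rightarrow> 'g) \<Rightarrow> ('h \<Rightarrow> 'g) \<Rightarrow>
   ('n \<Rightarrow> bit) \<Rightarrow> ('n \<Rightarrow> 'h) \<Rightarrow> ('n \<Rightarrow> 'h \<Rightarrow> complex) \<Rightarrow>
   (complex \<Rightarrow> 'v::ab_group_add \<Rightarrow> 'v) \<Rightarrow> ('g \<Rightarrow> 'v \<Rightarrow> 'v) \<Rightarrow> bool" where
  "integrable_module gscale gr br H p hc rt vscale act \<longleftrightarrow>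
     weight_module H vscale act \<and>
     (\<forall>\<beta>. real_root gscale gr br H p hc rt \<beta> \<longrightarrow>
        (\<forall>x\<in>root_space gscale br H \<beta>. \<forall>v. \<exists>N. (act x ^^ N) v = 0))"

text \<open>
  \<open>L(lam)\<close>, characterized up to isomorphism.  Neither homogeneity of the highest weight vector
  nor its parity is prescribed.
\<close>

locale irreducible_highest_weight_module =
  lie_supermodule gscale gr br vscale vgr act
  for hscale :: "complex \<Rightarrow> 'h::ab_group_add \<Rightarrow> 'h"
    and gscale :: "complex \<Rightarrow> 'g::ab_group_add \<Rightarrow> 'g"
    and gr :: "bit \<Rightarrow> 'g set" and br :: "'g \<Rightarrow> 'g \<Rightarrow> 'g"
    and H :: "'h \<Rightarrow> 'g" and X :: "'n \<Rightarrow> 'g"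
    and vscale :: "complex \<Rightarrow> 'v::ab_group_add \<Rightarrow> 'v"
    and vgr :: "bit \<Rightarrow> 'v set" and act :: "'g \<Rightarrow> 'v \<Rightarrow> 'v" +
  fixes lam :: "'h \<Rightarrow> complex"
  assumes weight_linear: "Vector_Spaces.linear hscale (*) lam"
    and irreducible: "submodule vscale vgr act W \<Longrightarrow> W = {0} \<or> W = UNIV"
    and highest_weight_vector:
      "\<exists>v. v \<noteq> 0 \<and>
         (\<forall>x\<in>generated_subalgebra gscale br (range X). act x v = 0) \<and>
         (\<forall>h. act (H h) v = vscale (lam h) v) \<and>
         (\<forall>W. submodule vscale vgr act W \<and> v \<in> W \<longrightarrow> W = UNIV)"

end

theory Submission
  imports Defs
begin

text \<open>
  The Serre relations needed hold because, by maximality of the ideal, a weight vector of positive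
  weight killed by all \<open>Y\<^sub>i\<close> generates an ideal inside the positive part and hence vanishes. For
  every base, triangular decomposition makes the simple root spaces one-dimensional, so the base
  determines its Cartan matrix up to rescaling rows. Starting from \<open>S(1,2,\<beta>)\<close>, even reflections
  keep \<open>\<beta>\<close> and odd ones replace \<open>1/\<beta>\<close> by \<open>1 - 1/\<beta>\<close>, up to the sign of \<open>\<beta>\<close>; since \<open>1/\<beta>\<close> is
  never an integer, every reflected base is again of this shape, and no real root vanishes on \<open>h\<^sub>1\<close>.

  If \<open>L(\<lambda>)\<close> is integrable, \<open>sl\<^sub>2\<close>-theory for \<open>\<alpha>\<^sub>1\<close>, and for \<open>\<alpha>\<^sub>2 + \<alpha>\<^sub>3\<close> in the base reflected
  at \<open>\<alpha>\<^sub>2\<close>, gives the conditions: the highest weight for that base is \<open>\<lambda> - \<alpha>\<^sub>2\<close> or, if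
  \<open>\<lambda>\<^sub>2 = 0\<close>, still \<open>\<lambda>\<close>. Conversely the conditions make both negative root vectors locally
  nilpotent, so the set of weights is invariant under the two reflections. Their product translates
  a root by a multiple of \<open>\<alpha>\<^sub>1 + \<alpha>\<^sub>2 + \<alpha>\<^sub>3\<close>, which moves every real root to one with a positive
  coefficient; as the weights lie below \<open>\<lambda>\<close>, all real root vectors are locally nilpotent.
\<close>

section \<open>Weight spaces\<close>

lemma lin_add: "Vector_Spaces.linear s t f \<Longrightarrow> f (x + y) = f x + f y"
  and lin_scale: "Vector_Spaces.linear s t f \<Longrightarrow> f (s c x) = t c (f x)"
  and lin_zero: "Vector_Spaces.linear s t f \<Longrightarrow> f 0 = 0"
  and lin_minus: "Vector_Spaces.linear s t f \<Longrightarrow> f (- x) = - f x"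
  and lin_diff: "Vector_Spaces.linear s t f \<Longrightarrow> f (x - y) = f x - f y"
  and lin_sum: "Vector_Spaces.linear s t f \<Longrightarrow> f (sum g A) = (\<Sum>i\<in>A. f (g i))"
  by (auto dest!: Vector_Spaces.linear.axioms(3)
      intro: module_hom.add module_hom.scale module_hom.zero module_hom.neg module_hom.diff module_hom.sum)

context super_space
begin

text \<open>Independence of weight vectors: for \<open>h\<close> separating \<open>\<kappa>\<close>
  from \<open>\<mu>\<close>, the operator \<open>act (H h)\<close> minus \<open>\<kappa> h\<close>
  kills the summand of weight \<open>\<kappa>\<close> and multiplies \<open>w\<close> by a nonzero
  scalar, so induction applies.\<close>

lemma weight_sum_zero:
  assumes lin: "\<And>h. Vector_Spaces.linear sc sc (act (H h))"
    and "finite F" "\<And>\<nu>. \<nu> \<in> F \<Longrightarrow> f \<nu> \<in> weight_space H sc act \<nu>"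
    and "w \<in> weight_space H sc act \<mu>" "\<mu> \<notin> F" "w = (\<Sum>\<nu>\<in>F. f \<nu>)"
  shows "w = 0"
  using assms(2-)
proof (induction F arbitrary: f w rule: finite_induct)
  case empty
  then show ?case by simp
next
  case (insert \<kappa> F)
  from insert.prems(3) obtain h where h: "\<kappa> h \<noteq> \<mu> h" by fastforce
  note [simp] = lin_add[OF lin] lin_scale[OF lin] lin_zero[OF lin] lin_diff[OF lin] lin_sum[OF lin]
  let ?f = "\<lambda>\<nu>. sc (\<nu> h - \<kappa> h) (f \<nu>)"
  have act_f: "act (H h) (f \<nu>) = sc (\<nu> h) (f \<nu>)" if "\<nu> \<in> insert \<kappa> F" for \<nu>
    using insert.prems(1)[OF that] by (simp add: weight_space_def)
  have "sc (\<mu> h - \<kappa> h) w = act (H h) w - sc (\<kappa> h) w"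
    using insert.prems(2) by (simp add: weight_space_def scale_left_diff_distrib)
  also have "\<dots> = (\<Sum>\<nu>\<in>insert \<kappa> F. act (H h) (f \<nu>) - sc (\<kappa> h) (f \<nu>))"
    unfolding insert.prems(4) by (simp only: lin_sum[OF lin] scale_sum_right sum_subtractf)
  also have "\<dots> = (\<Sum>\<nu>\<in>insert \<kappa> F. ?f \<nu>)"
    by (intro sum.cong refl) (simp add: act_f scale_left_diff_distrib)
  also have "\<dots> = (\<Sum>\<nu>\<in>F. ?f \<nu>)"
    using insert.hyps by simp
  finally have eq: "sc (\<mu> h - \<kappa> h) w = (\<Sum>\<nu>\<in>F. ?f \<nu>)" .
  have "sc (\<mu> h - \<kappa> h) w = 0"
  proof (rule insert.IH[OF _ _ _ eq])
    show "?f \<nu> \<in> weight_space H sc act \<nu>" if "\<nu> \<in> F" for \<nu>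
      using insert.prems(1)[of \<nu>] that by (simp add: weight_space_def mult.commute)
    show "sc (\<mu> h - \<kappa> h) w \<in> weight_space H sc act \<mu>"
      using insert.prems(2) by (simp add: weight_space_def mult.commute)
  qed (use insert.prems in auto)
  then show ?case using h by simp
qed

lemma weight_span_sum:
  assumes lin: "\<And>h. Vector_Spaces.linear sc sc (act (H h))"
    and "w \<in> span (\<Union>\<nu>\<in>M. weight_space H sc act \<nu>)"
  shows "\<exists>F f. finite F \<and> F \<subseteq> M \<and> (\<forall>\<nu>. f \<nu> \<in> weight_space H sc act \<nu>) \<and> w = (\<Sum>\<nu>\<in>F. f \<nu>)"
  using assms(2)
proof (induction rule: span_induct_alt)
  case base
  have "0 \<in> weight_space H sc act \<nu>" for \<nu> by (simp add: weight_space_def lin_zero[OF lin])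
  then show ?case by (intro exI[of _ "{}"] exI[of _ "\<lambda>_. 0"]) auto
next
  case (step c x y)
  then obtain F f \<kappa> where F: "finite F" "F \<subseteq> M" "\<And>\<nu>. f \<nu> \<in> weight_space H sc act \<nu>"
    "y = (\<Sum>\<nu>\<in>F. f \<nu>)" and x: "\<kappa> \<in> M" "x \<in> weight_space H sc act \<kappa>"
    by auto
  \<comment> \<open>The new vector is merged into the summand of its own weight.\<close>
  define g where "g \<nu> = (if \<nu> \<in> F then f \<nu> else 0) + (if \<nu> = \<kappa> then sc c x else 0)" for \<nu>
  have "g \<nu> \<in> weight_space H sc act \<nu>" for \<nu>
    using F(3)[of \<nu>] x(2)
    by (auto simp: g_def weight_space_def lin_add[OF lin] lin_scale[OF lin] lin_zero[OF lin]
        algebra_simps scale_right_distrib mult.commute)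
  moreover have "sc c x + y = (\<Sum>\<nu>\<in>insert \<kappa> F. g \<nu>)"
    unfolding g_def sum.distrib F(4) using F(1)
    by (simp add: add.commute sum.If_cases Int_insert_left insert_absorb)
  ultimately show ?case
    using F(1,2) x(1) by (intro exI[of _ "insert \<kappa> F"] exI[of _ g]) auto
qed

text \<open>Independence in the form used for trivial intersections, root spaces and the location of
  weights.\<close>

lemma weight_space_span_eq_0:
  assumes lin: "\<And>h. Vector_Spaces.linear sc sc (act (H h))"
    and "w \<in> span (\<Union>\<nu>\<in>M. weight_space H sc act \<nu>)"
    and "w \<in> weight_space H sc act \<mu>" "\<mu> \<notin> M"
  shows "w = 0"
  using weight_span_sum[OF lin assms(2)] weight_sum_zero[where act=act and H=H and w=w and \<mu>=\<mu>, OF lin] assms(3,4)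
  by (metis subsetD)

end

section \<open>Homogeneous components in a superspace\<close>

context super_space
begin

lemma gr_add: "x \<in> gr a \<Longrightarrow> y \<in> gr a \<Longrightarrow> x + y \<in> gr a"
  and gr_diff: "x \<in> gr a \<Longrightarrow> y \<in> gr a \<Longrightarrow> x - y \<in> gr a"
  and gr_scale: "x \<in> gr a \<Longrightarrow> sc c x \<in> gr a"
  and gr_zero: "0 \<in> gr a"
  and gr_minus: "x \<in> gr a \<Longrightarrow> - x \<in> gr a"
  using gr_subspace[of a] subspace_neg
  by (auto simp: subspace_add subspace_diff subspace_scale subspace_0)

lemma gr_cases: obtains x y where "x \<in> gr 0" "y \<in> gr 1" "v = x + y"
  using gr_sum by blast

lemma gr_unique: assumes "x \<in> gr a" "x \<in> gr b" "a \<noteq> b" shows "x = 0"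
  using gr_direct assms by (cases a; cases b) auto

lemma gr_sum_0:
  assumes "x \<in> gr a" "y \<in> gr b" "a \<noteq> b" "x + y = 0"
  shows "x = 0" "y = 0"
proof -
  have "x = - y" using assms(4) by (simp add: eq_neg_iff_add_eq_0)
  then show "x = 0" using gr_unique assms(1-3) gr_minus by metis
  then show "y = 0" using assms(4) by simp
qed

lemma gr_sum_eq:
  assumes "x \<in> gr a" "y \<in> gr b" "x' \<in> gr a" "y' \<in> gr b" "a \<noteq> b" "x + y = x' + y'"
  shows "x = x'" "y = y'"
proof -
  have "(x - x') + (y - y') = 0" using assms(6) by (simp add: algebra_simps)
  then show "x = x'" "y = y'"
    using gr_sum_0[of "x - x'" a "y - y'" b] assms(1-5) gr_diff by auto
qed

end

lemma super_sign_simps [simp]: "super_sign 0 a = 1" "super_sign a 0 = 1" "super_sign 1 1 = -1"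
  by (simp_all add: super_sign_def)

lemma super_sign_square [simp]: "super_sign a b * super_sign a b = 1"
  by (simp add: super_sign_def)

section \<open>Bracket identities and the adjoint module\<close>

context lie_superalgebra
begin

lemmas br_add_right = lin_add[OF br_linear_right]
lemmas br_add_left = lin_add[OF br_linear_left]
lemmas br_diff_right = lin_diff[OF br_linear_right]
lemmas br_diff_left = lin_diff[OF br_linear_left]
lemmas br_scale_right = lin_scale[OF br_linear_right]
lemmas br_scale_left = lin_scale[OF br_linear_left]
lemmas br_zero_right = lin_zero[OF br_linear_right]
lemmas br_zero_left = lin_zero[OF br_linear_left]
lemmas br_minus_right = lin_minus[OF br_linear_right]
lemmas br_minus_left = lin_minus[OF br_linear_left]
lemmas br_simps = br_add_right br_add_left br_diff_right br_diff_left br_scale_right br_scale_left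
  br_zero_right br_zero_left br_minus_right br_minus_left

lemma jacobi:
  assumes "x \<in> gr a" "y \<in> gr b"
  shows "br x (br y z) = br (br x y) z + sc (super_sign a b) (br y (br x z))"
proof -
  obtain u v where "u \<in> gr 0" "v \<in> gr 1" "z = u + v" by (rule gr_cases)
  then show ?thesis
    using br_super_jacobi[OF assms, of u 0] br_super_jacobi[OF assms, of v 1]
    by (simp add: br_simps scale_right_distrib)
qed

lemma antisym_even:
  assumes "x \<in> gr 0" shows "br x y = - br y x"
proof -
  obtain u v where "u \<in> gr 0" "v \<in> gr 1" "y = u + v" by (rule gr_cases)
  then show ?thesis
    using br_super_antisym[OF assms, of u 0] br_super_antisym[OF assms, of v 1]
    by (simp add: br_simps)
qed

text \<open>Lets ideals and root spaces be treated as submodules and weight spaces.\<close>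

lemma adjoint: "lie_supermodule sc gr br sc gr br"
proof (intro lie_supermodule.intro lie_superalgebra_axioms super_space_axioms
    lie_supermodule_axioms.intro br_linear_right br_linear_left br_graded)
  fix x y v a b assume "x \<in> gr a" "y \<in> gr b"
  from jacobi[OF this, of v]
  show "br (br x y) v = br x (br y v) - sc (super_sign a b) (br y (br x v))" by simp
qed

end

section \<open>Weights, generators and nilpotency in supermodules\<close>

context lie_supermodule
begin

lemmas act_add_right = lin_add[OF act_linear_right]
lemmas act_add_left = lin_add[OF act_linear_left]
lemmas act_diff_right = lin_diff[OF act_linear_right]
lemmas act_diff_left = lin_diff[OF act_linear_left]
lemmas act_scale_right = lin_scale[OF act_linear_right]
lemmas act_scale_left = lin_scale[OF act_linear_left]
lemmas act_zero_right = lin_zero[OF act_linear_right]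
lemmas act_zero_left = lin_zero[OF act_linear_left]
lemmas act_minus_right = lin_minus[OF act_linear_right]
lemmas act_minus_left = lin_minus[OF act_linear_left]
lemmas act_simps = act_add_right act_add_left act_diff_right act_diff_left act_scale_right
  act_scale_left act_zero_right act_zero_left act_minus_right act_minus_left

lemma act_act:
  assumes "x \<in> ggr a" "y \<in> ggr b"
  shows "act x (act y v) = act (br x y) v + vscale (super_sign a b) (act y (act x v))"
  using act_br[OF assms, of v] by simp

lemma act_even:
  assumes "x \<in> ggr 0"
  shows "act x (act y v) = act (br x y) v + act y (act x v)"
proof -
  obtain u w where "u \<in> ggr 0" "w \<in> ggr 1" "y = u + w" by (rule gr_cases)
  then show ?thesis
    using act_act[OF assms, of u 0] act_act[OF assms, of w 1]
    by (simp add: br_simps act_simps)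
qed

lemma act_weight:
  assumes "\<And>h. H h \<in> ggr 0" "x \<in> root_space gscale br H \<beta>" "v \<in> weight_space H vscale act \<mu>"
  shows "act x v \<in> weight_space H vscale act (\<lambda>h. \<mu> h + \<beta> h)"
  using assms(2,3)
  by (auto simp: weight_space_def root_space_def act_even[OF assms(1)] act_simps
      V.scale_left_distrib)

lemma subspace_weight_space: "V.subspace (weight_space H vscale act \<mu>)"
  by (auto simp: V.subspace_def weight_space_def act_simps V.scale_right_distrib mult.commute)

lemma weight_space_gr:
  assumes "\<And>h. H h \<in> ggr 0" "x \<in> vgr 0" "y \<in> vgr 1" "x + y \<in> weight_space H vscale act \<mu>"
  shows "x \<in> weight_space H vscale act \<mu>" "y \<in> weight_space H vscale act \<mu>"
proof -
  have "act (H h) x = vscale (\<mu> h) x \<and> act (H h) y = vscale (\<mu> h) y" for h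
  proof -
    have "act (H h) x \<in> vgr 0" "act (H h) y \<in> vgr 1"
      using act_graded[OF assms(1,2)] act_graded[OF assms(1,3)] by auto
    moreover have "act (H h) x + act (H h) y = vscale (\<mu> h) x + vscale (\<mu> h) y"
      using assms(4) by (simp add: weight_space_def act_simps V.scale_right_distrib)
    ultimately show ?thesis
      using V.gr_sum_eq[of _ 0 _ 1] V.gr_scale assms(2,3) by (metis zero_neq_one)
  qed
  then show "x \<in> weight_space H vscale act \<mu>" "y \<in> weight_space H vscale act \<mu>"
    by (auto simp: weight_space_def)
qed

text \<open>Induction over generators. As \<open>act_br\<close> concerns homogeneous elements, the
  elements whose even and odd parts both preserve \<open>W\<close> are shown to form a
  subalgebra.\<close>

lemma stable_generated:
  assumes gen: "generated_subalgebra gscale br S = UNIV"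
    and W: "V.subspace W"
    and S: "\<And>s. s \<in> S \<Longrightarrow> (\<exists>a. s \<in> ggr a) \<and> (\<forall>w\<in>W. act s w \<in> W)"
    and "w \<in> W"
  shows "act x w \<in> W"
proof -
  define st where "st z \<longleftrightarrow> (\<forall>w\<in>W. act z w \<in> W)" for z
  define N where "N = {x. \<exists>y\<in>ggr 0. \<exists>z\<in>ggr 1. x = y + z \<and> st y \<and> st z}"
  have st_add: "st (y + z)" if "st y" "st z" for y z
    using that W by (simp add: st_def act_simps V.subspace_add)
  have st_scale: "st (gscale c y)" if "st y" for c y
    using that W by (simp add: st_def act_simps V.subspace_scale)
  have st_0: "st 0" using W by (simp add: st_def act_simps V.subspace_0)
  have st_br: "st (br y z)" if "st y" "st z" "y \<in> ggr a" "z \<in> ggr b" for y z a b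
    using that W by (simp add: st_def act_br[OF that(3,4)] V.subspace_diff V.subspace_scale)
  have "subspace N"
  proof (rule subspaceI)
    show "0 \<in> N" using st_0 gr_zero by (force simp: N_def)
  next
    fix x x' assume "x \<in> N" "x' \<in> N"
    then obtain y z y' z' where *: "y \<in> ggr 0" "z \<in> ggr 1" "x = y + z" "st y" "st z"
      "y' \<in> ggr 0" "z' \<in> ggr 1" "x' = y' + z'" "st y'" "st z'" by (auto simp: N_def)
    show "x + x' \<in> N" unfolding N_def
      by (rule CollectI, rule bexI[of _ "y + y'"], rule bexI[of _ "z + z'"])
        (use * in \<open>auto intro: st_add gr_add simp: algebra_simps\<close>)
  next
    fix c x assume "x \<in> N"
    then obtain y z where *: "y \<in> ggr 0" "z \<in> ggr 1" "x = y + z" "st y" "st z" by (auto simp: N_def)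
    show "gscale c x \<in> N" unfolding N_def
      by (rule CollectI, rule bexI[of _ "gscale c y"], rule bexI[of _ "gscale c z"])
        (use * in \<open>auto intro: st_scale gr_scale simp: scale_right_distrib\<close>)
  qed
  moreover have "br x x' \<in> N" if "x \<in> N" "x' \<in> N" for x x'
  proof -
    from that obtain y z y' z' where *: "y \<in> ggr 0" "z \<in> ggr 1" "x = y + z" "st y" "st z"
      "y' \<in> ggr 0" "z' \<in> ggr 1" "x' = y' + z'" "st y'" "st z'" by (auto simp: N_def)
    have "br y y' + br z z' \<in> ggr 0" "br y z' + br z y' \<in> ggr 1"
      using br_graded[OF *(1,6)] br_graded[OF *(2,7)] br_graded[OF *(1,7)] br_graded[OF *(2,6)]
      by (auto intro: gr_add)
    moreover have "st (br y y' + br z z')" "st (br y z' + br z y')"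
      using * by (auto intro!: st_add intro: st_br)
    moreover have "br x x' = (br y y' + br z z') + (br y z' + br z y')"
      by (simp add: * br_simps algebra_simps)
    ultimately show ?thesis unfolding N_def by blast
  qed
  moreover have "S \<subseteq> N"
  proof
    fix s assume "s \<in> S"
    from S[OF this] obtain a where a: "s \<in> ggr a" and st: "st s" by (auto simp: st_def)
    show "s \<in> N" unfolding N_def
      using a st st_0 gr_zero by (cases a) force+
  qed
  ultimately have "generated_subalgebra gscale br S \<subseteq> N"
    unfolding generated_subalgebra_def by blast
  with gen have "x \<in> N" by auto
  then show ?thesis
    using st_add \<open>w \<in> W\<close> by (auto simp: N_def st_def)
qed

text \<open>Exponents add up: if the powers \<open>M\<close> and \<open>N\<close> kill two vectors,
  the power \<open>M + N\<close> kills their combinations. So local nilpotency may be tested on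
  weight vectors.\<close>

lemma nilpotent_weight_generated:
  fixes H :: "'h \<Rightarrow> 'g"
  assumes wm: "weight_module H vscale act"
    and nil: "\<And>\<mu> w. w \<in> weight_space H vscale act \<mu> \<Longrightarrow> \<exists>N. (act x ^^ N) w = 0"
  shows "\<exists>N. (act x ^^ N) v = 0"
proof -
  have lin: "(act x ^^ N) (u + w) = (act x ^^ N) u + (act x ^^ N) w"
    "(act x ^^ N) (vscale c u) = vscale c ((act x ^^ N) u)" "(act x ^^ N) 0 = 0" for N c u w
    by (induction N) (auto simp: act_simps)
  have mono: "(act x ^^ (M + N)) w = 0" if "(act x ^^ N) w = 0" for M N w
    using that by (simp add: funpow_add lin)
  have "v \<in> V.span (\<Union>\<mu>. weight_space H vscale act \<mu>)" using wm by (simp add: weight_module_def)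
  then show ?thesis
  proof (induction rule: V.span_induct_alt)
    case base
    show ?case by (rule exI[of _ 0]) simp
  next
    case (step c u w)
    then obtain M N where "(act x ^^ M) u = 0" "(act x ^^ N) w = 0" using nil by blast
    then have "(act x ^^ (M + N)) (vscale c u + w) = 0"
      using mono[of N w M] mono[of M u N] by (simp add: lin add.commute)
    then show ?case ..
  qed
qed

end

section \<open>Chevalley generators\<close>

text \<open>Replaces enveloping algebras: with \<open>f i = act (Y i)\<close> the span is all that
  the algebra generated by these operators makes of \<open>S\<close>; with
  \<open>f i = br (X i)\<close> and \<open>S = range X\<close> the words are right-nested
  brackets.\<close>

inductive_set words :: "('i \<Rightarrow> 'v \<Rightarrow> 'v) \<Rightarrow> 'v set \<Rightarrow> 'v set"
  for f :: "'i \<Rightarrow> 'v \<Rightarrow> 'v" and S :: "'v set" where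
  base: "s \<in> S \<Longrightarrow> s \<in> words f S"
| step: "w \<in> words f S \<Longrightarrow> f i w \<in> words f S"

text \<open>The weights below \<mu>, that is, \<mu> minus the positive cone of the root
  lattice.\<close>

definition weight_cone :: "('n::finite \<Rightarrow> 'h \<Rightarrow> complex) \<Rightarrow> ('h \<Rightarrow> complex) \<Rightarrow> ('h \<Rightarrow> complex) set" where
  "weight_cone a \<mu> = {\<phi>. \<exists>n::'n \<Rightarrow> nat. \<phi> = (\<lambda>x. \<mu> x - (\<Sum>i\<in>UNIV. of_nat (n i) * a i x))}"

lemma weight_cone_self: "\<mu> \<in> weight_cone a \<mu>"
  by (auto simp: weight_cone_def intro!: exI[of _ "\<lambda>_. 0"])

lemma weight_cone_step:
  fixes a :: "'n::finite \<Rightarrow> 'h \<Rightarrow> complex"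
  assumes "\<phi> \<in> weight_cone a \<mu>" shows "(\<lambda>x. \<phi> x + - a k x) \<in> weight_cone a \<mu>"
proof -
  obtain n :: "'n \<Rightarrow> nat" where n: "\<phi> = (\<lambda>x. \<mu> x - (\<Sum>i\<in>UNIV. of_nat (n i) * a i x))"
    using assms by (auto simp: weight_cone_def)
  have "(\<Sum>i\<in>UNIV. of_nat ((n(k := Suc (n k))) i) * a i x) = (\<Sum>i\<in>UNIV. of_nat (n i) * a i x) + a k x" for x
  proof -
    have "(\<Sum>i\<in>UNIV. of_nat ((n(k := Suc (n k))) i) * a i x)
      = (\<Sum>i\<in>UNIV. of_nat (n i) * a i x + (if i = k then a k x else 0))"
      by (intro sum.cong) (auto simp: algebra_simps)
    then show ?thesis by (simp add: sum.distrib)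
  qed
  then show ?thesis unfolding weight_cone_def n
    by (intro CollectI exI[of _ "n(k := Suc (n k))"]) (simp add: fun_eq_iff del: fun_upd_apply)
qed

lemma (in super_space) graded_span:
  assumes "\<And>x. x \<in> S \<Longrightarrow> \<exists>a. x \<in> gr a"
  shows "graded_subspace sc gr (span S)"
  unfolding graded_subspace_def
proof (intro conjI ballI)
  fix u assume "u \<in> span S"
  then show "\<exists>x\<in>span S \<inter> gr 0. \<exists>y\<in>span S \<inter> gr 1. u = x + y"
  proof (induction rule: span_induct_alt)
    case base
    then show ?case using gr_zero span_zero by (metis Int_iff add_0)
  next
    case (step c s u)
    then obtain x y where xy: "x \<in> span S" "x \<in> gr 0" "y \<in> span S" "y \<in> gr 1" "u = x + y" by blast
    obtain a where a: "s \<in> gr a" using assms step(1) by blast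
    have s: "sc c s \<in> span S" "sc c s \<in> gr a" using step(1) a by (auto intro: span_base span_scale gr_scale)
    show ?case
    proof (cases a)
      case zero
      with xy s show ?thesis
        by (intro bexI[of _ "sc c s + x"] bexI[of _ y]) (auto intro: span_add gr_add simp: algebra_simps)
    next
      case one
      with xy s show ?thesis
        by (intro bexI[of _ x] bexI[of _ "sc c s + y"]) (auto intro: span_add gr_add simp: algebra_simps)
    qed
  qed
qed (rule subspace_span)

text \<open>The data independent of a base. \<open>ideal_trivial\<close> is what maximality of the
  ideal in the presentation becomes in the quotient.\<close>

locale cartan = lie_superalgebra gscale gr br + h: vector_space hscale
  for hscale :: "complex \<Rightarrow> 'h::ab_group_add \<Rightarrow> 'h"
    and gscale :: "complex \<Rightarrow> 'g::ab_group_add \<Rightarrow> 'g"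
    and gr :: "bit \<Rightarrow> 'g set" and br :: "'g \<Rightarrow> 'g \<Rightarrow> 'g" +
  fixes H :: "'h \<Rightarrow> 'g"
  assumes H_linear: "Vector_Spaces.linear hscale gscale H"
    and H_even: "H x \<in> gr 0"
    and H_H: "br (H x) (H y) = 0"
    and ideal_trivial: "\<lbrakk>super_ideal gscale gr br J; J \<inter> range H \<subseteq> {0}\<rbrakk> \<Longrightarrow> J \<subseteq> {0}"

locale chev_system = cartan hscale gscale gr br H
  for hscale :: "complex \<Rightarrow> 'h::ab_group_add \<Rightarrow> 'h"
    and gscale :: "complex \<Rightarrow> 'g::ab_group_add \<Rightarrow> 'g"
    and gr :: "bit \<Rightarrow> 'g set" and br :: "'g \<Rightarrow> 'g \<Rightarrow> 'g"
    and H :: "'h \<Rightarrow> 'g" +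
  fixes q :: "'n::finite \<Rightarrow> bit" and h :: "'n \<Rightarrow> 'h" and a :: "'n \<Rightarrow> 'h \<Rightarrow> complex"
    and X Y :: "'n \<Rightarrow> 'g"
  assumes a_linear: "Vector_Spaces.linear hscale (*) (a i)"
    and a_independent: "(\<And>x. (\<Sum>i\<in>UNIV. c i * a i x) = 0) \<Longrightarrow> c i = 0"
    and X_root: "X i \<in> root_space gscale br H (a i)"
    and Y_root: "Y i \<in> root_space gscale br H (\<lambda>x. - a i x)"
    and X_gr: "X i \<in> gr (q i)"
    and Y_gr: "Y i \<in> gr (q i)"
    and X_Y: "br (X i) (Y j) = (if i = j then H (h i) else 0)"
    and generates: "generated_subalgebra gscale br (range H \<union> range X \<union> range Y) = UNIV"
begin

lemma H_X: "br (H x) (X i) = gscale (a i x) (X i)"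
  and H_Y: "br (H x) (Y i) = gscale (- a i x) (Y i)"
  using X_root[of i] Y_root[of i] by (auto simp: root_space_def)

lemma X_H: "br (X i) (H x) = gscale (- a i x) (X i)"
  and Y_H: "br (Y i) (H x) = gscale (a i x) (Y i)"
  using antisym_even[OF H_even, of x "X i"] antisym_even[OF H_even, of x "Y i"]
  by (simp_all add: H_X H_Y minus_equation_iff[of _ "br _ _"] eq_commute[of "- br _ _"])

lemma Y_X: "br (Y i) (X j) = (if i = j then gscale (- super_sign (q i) (q i)) (H (h i)) else 0)"
  using br_super_antisym[OF Y_gr X_gr, of i j] X_Y[of j i] by (auto simp: br_simps)

text \<open>Replaces the Chevalley involution: exchanging \<open>X\<close> and \<open>Y\<close>
  gives generators for the negated base. The factor in the coroots comes from super antisymmetry of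
  \<open>br (Y i) (X i)\<close>.\<close>

lemma flip: "chev_system hscale gscale gr br H q
   (\<lambda>i. hscale (- super_sign (q i) (q i)) (h i)) (\<lambda>i x. - a i x) Y X"
proof (intro chev_system.intro chev_system_axioms.intro cartan_axioms)
  show "Vector_Spaces.linear hscale (*) (\<lambda>x. - a i x)" for i
    using a_linear[of i] unfolding Vector_Spaces.linear_iff by auto
  show "c i = 0" if "\<And>x. (\<Sum>i\<in>UNIV. c i * - a i x) = 0" for c i
    using a_independent[of c i] that by (simp add: sum_negf)
  show "generated_subalgebra gscale br (range H \<union> range Y \<union> range X) = UNIV"
    using generates by (simp add: Un_ac)
qed (auto simp: X_root Y_root X_gr Y_gr Y_X lin_scale[OF H_linear] lin_minus[OF H_linear])

lemma weight_eq_imp: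
  assumes "\<And>x. (\<Sum>i\<in>UNIV. c i * a i x) = (\<Sum>i\<in>UNIV. d i * a i x)"
  shows "c = d"
proof
  fix i
  have "c i - d i = 0"
    by (rule a_independent[of "\<lambda>i. c i - d i"]) (simp add: assms left_diff_distrib sum_subtractf)
  then show "c i = d i" by simp
qed

lemma a_eq_sum: "a i x = (\<Sum>j\<in>UNIV. (if j = i then 1 else 0) * a j x)"
  by (simp add: if_distrib[of "\<lambda>c. c * _"] cong: if_cong)

end

section \<open>Singular vectors and the submodules they generate\<close>

locale chev_module = chev_system hscale gscale gr br H q h a X Y +
  lie_supermodule gscale gr br vscale vgr act
  for hscale :: "complex \<Rightarrow> 'h::ab_group_add \<Rightarrow> 'h"
    and gscale :: "complex \<Rightarrow> 'g::ab_group_add \<Rightarrow> 'g"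
    and gr :: "bit \<Rightarrow> 'g set" and br :: "'g \<Rightarrow> 'g \<Rightarrow> 'g"
    and H :: "'h \<Rightarrow> 'g"
    and q :: "'n::finite \<Rightarrow> bit" and h :: "'n \<Rightarrow> 'h" and a :: "'n \<Rightarrow> 'h \<Rightarrow> complex"
    and X Y :: "'n \<Rightarrow> 'g"
    and vscale :: "complex \<Rightarrow> 'v::ab_group_add \<Rightarrow> 'v"
    and vgr :: "bit \<Rightarrow> 'v set" and act :: "'g \<Rightarrow> 'v \<Rightarrow> 'v"
begin

abbreviation "Wt \<equiv> weight_space H vscale act"
abbreviation "Ywords \<equiv> words (\<lambda>i. act (Y i))"

lemma span_act:
  assumes "\<And>w. w \<in> S \<Longrightarrow> act x w \<in> V.span T" "w \<in> V.span S"
  shows "act x w \<in> V.span T"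
  using assms(2)
proof (induction rule: V.span_induct_alt)
  case base
  then show ?case by (simp add: act_simps V.span_zero)
next
  case (step c u w)
  then show ?case by (simp add: act_simps assms(1) V.span_add V.span_scale)
qed

lemma words_weight:
  assumes "s \<in> Wt \<mu>" "w \<in> Ywords {s}"
  shows "\<exists>\<phi>\<in>weight_cone a \<mu>. w \<in> Wt \<phi>"
  using assms(2)
proof induction
  case (base s')
  then show ?case using assms(1) weight_cone_self by auto
next
  case (step w i)
  then obtain \<phi> where "\<phi> \<in> weight_cone a \<mu>" "w \<in> Wt \<phi>" by blast
  then show ?case
    using act_weight[OF H_even Y_root] weight_cone_step by blast
qed

lemma words_span:
  assumes "s \<in> Wt \<mu>"
  shows "V.span (Ywords {s}) \<subseteq> V.span (\<Union>\<nu>\<in>weight_cone a \<mu>. Wt \<nu>)"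
  by (rule V.span_mono) (use words_weight[OF assms] in auto)

text \<open>Moving \<open>X j\<close> past \<open>Y i\<close> costs \<open>br (X j) (Y i)\<close>,
  which acts on a weight vector by a scalar. \<open>T\<close> absorbs what \<open>X j\<close> makes
  of the starting vectors: it is empty for a singular vector and \<open>range H\<close> in
  \<open>triangular\<close>.\<close>

lemma words_raise:
  assumes S: "\<And>s. s \<in> S \<Longrightarrow> \<exists>\<mu>. s \<in> Wt \<mu>" "\<And>s j. s \<in> S \<Longrightarrow> act (X j) s \<in> V.span (Ywords S \<union> T)"
    and T: "\<And>w i. w \<in> T \<Longrightarrow> act (Y i) w \<in> V.span (Ywords S)"
    and w: "w \<in> Ywords S"
  shows "(\<exists>\<mu>. w \<in> Wt \<mu>) \<and> act (X j) w \<in> V.span (Ywords S \<union> T)"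
  using w
proof (induction arbitrary: j)
  case (base s)
  then show ?case using S by blast
next
  case (step w i)
  from step.IH obtain \<mu> where \<mu>: "w \<in> Wt \<mu>" by blast
  have *: "act (Y i) v \<in> V.span (Ywords S \<union> T)" if "v \<in> V.span (Ywords S \<union> T)" for v
  proof (rule span_act[OF _ that])
    fix v assume "v \<in> Ywords S \<union> T"
    then have "act (Y i) v \<in> V.span (Ywords S)"
      using T by (auto intro: V.span_base words.step)
    then show "act (Y i) v \<in> V.span (Ywords S \<union> T)"
      using V.span_mono[of "Ywords S" "Ywords S \<union> T"] by auto
  qed
  have "act (br (X j) (Y i)) w \<in> V.span (Ywords S \<union> T)"
    using \<mu> V.span_scale[OF V.span_base, of w "Ywords S \<union> T" "\<mu> (h i)"] step.hyps
    by (simp add: X_Y act_simps V.span_zero weight_space_def)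
  then have "act (X j) (act (Y i) w) \<in> V.span (Ywords S \<union> T)"
    using * step.IH unfolding act_act[OF X_gr Y_gr] by (blast intro: V.span_add V.span_scale)
  then show ?case using act_weight[OF H_even Y_root \<mu>] by blast
qed

lemma words_homogeneous:
  assumes "\<And>s. s \<in> S \<Longrightarrow> \<exists>b. s \<in> vgr b" "w \<in> Ywords S"
  shows "\<exists>b. w \<in> vgr b"
  using assms(2) by induction (use assms(1) act_graded[OF Y_gr] in blast)+

text \<open>The span is stable under \<open>H\<close> by weights, under \<open>Y\<close> by
  construction and under \<open>X\<close> by \<open>words_raise\<close>; it is graded because every
  word is homogeneous.\<close>

lemma hw_submodule:
  assumes "s \<in> vgr b" "s \<in> Wt \<mu>" "\<And>j. act (X j) s = 0"
  shows "submodule vscale vgr act (V.span (Ywords {s}))"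
  unfolding submodule_def
proof (intro conjI allI ballI)
  show "graded_subspace vscale vgr (V.span (Ywords {s}))"
    by (rule V.graded_span, rule words_homogeneous[of "{s}"]) (use assms(1) in auto)
  fix x w assume w: "w \<in> V.span (Ywords {s})"
  show "act x w \<in> V.span (Ywords {s})"
  proof (rule stable_generated[OF generates V.subspace_span _ w], intro conjI ballI)
    fix g assume g: "g \<in> range H \<union> range X \<union> range Y"
    then show "\<exists>a. g \<in> gr a" using H_even X_gr Y_gr by blast
    fix w assume w: "w \<in> V.span (Ywords {s})"
    show "act g w \<in> V.span (Ywords {s})"
    proof (rule span_act[OF _ w])
      fix w assume w: "w \<in> Ywords {s}"
      consider (H) x where "g = H x" | (X) i where "g = X i" | (Y) i where "g = Y i" using g by blast
      then show "act g w \<in> V.span (Ywords {s})"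
      proof cases
        case H
        obtain \<phi> where "w \<in> Wt \<phi>" using words_weight[OF assms(2) w] by blast
        then show ?thesis using w H by (auto simp: weight_space_def intro: V.span_scale V.span_base)
      next
        case X
        then show ?thesis
          using words_raise[of "{s}" "{}" w i] w assms by (auto simp: V.span_zero)
      next
        case Y
        then show ?thesis using w by (auto intro: V.span_base words.step)
      qed
    qed
  qed
qed

end

section \<open>Ideals, triangular decomposition and simple root spaces\<close>

context chev_system
begin

lemma adjoint_module: "chev_module hscale gscale gr br H q h a X Y gscale gr br"
  by (intro chev_module.intro chev_system_axioms adjoint)

text \<open>Passing from \<open>br y x\<close> to \<open>br x y\<close> uses super antisymmetry of
  homogeneous elements, so both are split; the parts of \<open>x\<close> stay in
  \<open>J\<close>.\<close>

lemma submodule_imp_ideal: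
  assumes "submodule gscale gr br J"
  shows "super_ideal gscale gr br J"
  unfolding super_ideal_def
proof (intro conjI ballI allI)
  have gJ: "graded_subspace gscale gr J" and st: "\<And>x w. w \<in> J \<Longrightarrow> br x w \<in> J"
    using assms by (auto simp: submodule_def)
  then show "graded_subspace gscale gr J" by blast
  have sub: "subspace J" using gJ by (simp add: graded_subspace_def)
  fix x y assume x: "x \<in> J"
  then show "br y x \<in> J" by (rule st)
  from gJ x obtain x0 x1 where x01: "x0 \<in> J" "x0 \<in> gr 0" "x1 \<in> J" "x1 \<in> gr 1" "x = x0 + x1"
    unfolding graded_subspace_def by blast
  obtain y0 y1 where y01: "y0 \<in> gr 0" "y1 \<in> gr 1" "y = y0 + y1" by (rule gr_cases)
  have "br x y = - br y x0 - br y0 x1 + br y1 x1"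
    using antisym_even[OF x01(2), of y] br_super_antisym[OF x01(4) y01(1)]
      br_super_antisym[OF x01(4) y01(2)]
    by (simp add: x01(5) y01(3) br_simps)
  then show "br x y \<in> J"
    using st x01(1,3) sub by (simp add: subspace_add subspace_diff subspace_neg)
qed

text \<open>After exchanging \<open>X\<close> and \<open>Y\<close>, \<open>x\<close> is a singular
  vector of the adjoint module. The weights of the ideal it generates keep a positive coefficient at
  \<open>k\<close>, so this ideal meets \<open>range H\<close> trivially.\<close>

lemma positive_singular_eq_0:
  assumes "x \<in> gr b" "x \<in> root_space gscale br H (\<lambda>z. \<Sum>i\<in>UNIV. of_nat (n i) * a i z)"
    and "n k \<noteq> 0" "\<And>j. br (Y j) x = 0"
  shows "x = 0"
proof -
  interpret F: chev_system hscale gscale gr br H q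
   "\<lambda>i. hscale (- super_sign (q i) (q i)) (h i)" "\<lambda>i x. - a i x" Y X by (rule flip)
  interpret F: chev_module hscale gscale gr br H q
   "\<lambda>i. hscale (- super_sign (q i) (q i)) (h i)" "\<lambda>i x. - a i x" Y X gscale gr br
    by (rule F.adjoint_module)
  have x: "x \<in> F.Wt (\<lambda>z. \<Sum>i\<in>UNIV. of_nat (n i) * a i z)"
    using assms(2) by (simp add: weight_space_def root_space_def)
  let ?M = "weight_cone (\<lambda>i x. - a i x) (\<lambda>z. \<Sum>i\<in>UNIV. of_nat (n i) * a i z)"
  let ?J = "span (F.Ywords {x})"
  have ideal: "super_ideal gscale gr br ?J"
    by (intro submodule_imp_ideal F.hw_submodule[OF assms(1) x] assms)
  have "y = 0" if "y \<in> ?J" "y \<in> range H" for y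
  proof (rule weight_space_span_eq_0[OF br_linear_right])
    show "y \<in> F.Wt (\<lambda>_. 0)" using that(2) by (auto simp: weight_space_def H_H)
    show "y \<in> span (\<Union>\<nu>\<in>?M. F.Wt \<nu>)"
      using that(1) F.words_span[OF x] by (rule subsetD[rotated])
    show "(\<lambda>_. 0) \<notin> ?M"
    proof
      assume "(\<lambda>_. 0) \<in> ?M"
      then obtain m :: "'n \<Rightarrow> nat" where
        m: "(\<lambda>_. 0) = (\<lambda>z. (\<Sum>i\<in>UNIV. of_nat (n i) * a i z) - (\<Sum>i\<in>UNIV. of_nat (m i) * - a i z))"
        by (auto simp: weight_cone_def)
      then have "0 = (\<Sum>i\<in>UNIV. of_nat (n i) * a i z) - (\<Sum>i\<in>UNIV. of_nat (m i) * - a i z)" for z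
        by (rule fun_cong)
      then have "(\<Sum>i\<in>UNIV. of_nat (n i + m i) * a i z) = 0" for z
        by (simp add: sum_negf ring_distribs sum.distrib)
      then have "(of_nat (n k + m k) :: complex) = 0" by (rule a_independent)
      then show False using assms(3) unfolding of_nat_eq_0_iff by simp
    qed
  qed
  then have "?J \<subseteq> {0}" by (intro ideal_trivial[OF ideal]) auto
  moreover have "x \<in> ?J" by (intro span_base words.base) simp
  ultimately show ?thesis by blast
qed

text \<open>The disjunction singles out \<open>X k\<close> among the words by height; this is what
  makes simple root spaces one-dimensional.\<close>

lemma X_words_weight:
  assumes "w \<in> words (\<lambda>i. br (X i)) (range X)"
  shows "\<exists>n::'n \<Rightarrow> nat. w \<in> root_space gscale br H (\<lambda>z. \<Sum>i\<in>UNIV. of_nat (n i) * a i z) \<and>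
    (sum n UNIV \<ge> 2 \<or> (\<exists>k. n = (\<lambda>i. if i = k then 1 else 0) \<and> w = X k))"
  using assms
proof induction
  case (base s)
  then obtain k where k: "s = X k" by blast
  have "s \<in> root_space gscale br H (\<lambda>z. \<Sum>i\<in>UNIV. of_nat (if i = k then 1 else 0) * a i z)"
    using X_root[of k] by (simp add: k if_distrib[of "\<lambda>c. of_nat c * _"] cong: if_cong)
  then show ?case using k by (intro exI[of _ "\<lambda>i. if i = k then 1 else 0"]) auto
next
  case (step w k)
  interpret A: chev_module hscale gscale gr br H q h a X Y gscale gr br by (rule adjoint_module)
  obtain n where n: "w \<in> A.Wt (\<lambda>z. \<Sum>i\<in>UNIV. of_nat (n i) * a i z)" "sum n UNIV \<ge> 1"
    using step.IH by (fastforce simp: root_space_def weight_space_def)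
  let ?m = "\<lambda>i. n i + (if i = k then 1 else 0)"
  have "br (X k) w \<in> A.Wt (\<lambda>z. \<Sum>i\<in>UNIV. of_nat (?m i) * a i z)"
    using A.act_weight[OF H_even X_root n(1), of k]
    by (simp add: distrib_right sum.distrib if_distrib[of "\<lambda>c. c * _"] if_distrib[of "\<lambda>c. of_nat c * _"] cong: if_cong)
  moreover have "sum ?m UNIV \<ge> 2" using n(2) by (simp add: sum.distrib)
  ultimately show ?case by (auto simp: root_space_def weight_space_def intro!: exI[of _ ?m])
qed

text \<open>The span is stable under bracketing with each generator: \<open>words_raise\<close> with
  \<open>T = range H\<close> covers lowering operators on raising words and conversely. It is then a
  subalgebra containing the generators.\<close>

lemma triangular:
  "span (range H \<union> words (\<lambda>i. br (X i)) (range X) \<union> words (\<lambda>i. br (Y i)) (range Y)) = UNIV"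
proof -
  interpret A: chev_module hscale gscale gr br H q h a X Y gscale gr br by (rule adjoint_module)
  interpret F: chev_system hscale gscale gr br H q
   "\<lambda>i. hscale (- super_sign (q i) (q i)) (h i)" "\<lambda>i x. - a i x" Y X by (rule flip)
  interpret F: chev_module hscale gscale gr br H q
   "\<lambda>i. hscale (- super_sign (q i) (q i)) (h i)" "\<lambda>i x. - a i x" Y X gscale gr br
    by (rule F.adjoint_module)
  let ?WX = "words (\<lambda>i. br (X i)) (range X)" and ?WY = "words (\<lambda>i. br (Y i)) (range Y)"
  let ?T = "span (range H \<union> ?WX \<union> ?WY)"
  have X_wt: "X i \<in> A.Wt (a i)" and Y_wt: "Y i \<in> A.Wt (\<lambda>x. - a i x)" for i
    using X_root[of i] Y_root[of i] by (auto simp: root_space_def weight_space_def)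
  have HT: "H x \<in> span (S \<union> range H)" for S x by (auto intro: span_base)
  have WY: "(\<exists>\<mu>. w \<in> A.Wt \<mu>) \<and> br (X j) w \<in> span (?WY \<union> range H)" if "w \<in> ?WY" for w j
  proof (rule A.words_raise[OF _ _ _ that])
    show "\<exists>\<mu>. s \<in> A.Wt \<mu>" if "s \<in> range Y" for s using that Y_wt by blast
    show "br (X j) s \<in> span (?WY \<union> range H)" if "s \<in> range Y" for s j
      using that HT by (auto simp: X_Y span_zero)
    show "br (Y i) w \<in> span ?WY" if w: "w \<in> range H" for w i
    proof -
      obtain x where "w = H x" using w by blast
      then show ?thesis by (simp only: Y_H) (intro span_scale span_base words.base rangeI)
    qed
  qed
  have WX: "(\<exists>\<mu>. w \<in> A.Wt \<mu>) \<and> br (Y j) w \<in> span (?WX \<union> range H)" if "w \<in> ?WX" for w j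
  proof (rule F.words_raise[OF _ _ _ that])
    show "\<exists>\<mu>. s \<in> A.Wt \<mu>" if "s \<in> range X" for s using that X_wt by blast
    show "br (Y j) s \<in> span (?WX \<union> range H)" if "s \<in> range X" for s j
      using that HT by (auto simp: Y_X span_zero intro!: span_neg span_scale)
    show "br (X i) w \<in> span ?WX" if w: "w \<in> range H" for w i
    proof -
      obtain x where "w = H x" using w by blast
      then show ?thesis by (simp only: X_H) (intro span_scale span_base words.base rangeI)
    qed
  qed
  have sub: "span (?WX \<union> range H) \<subseteq> ?T" "span (?WY \<union> range H) \<subseteq> ?T" by (intro span_mono; blast)+
  have X_mem: "X i \<in> ?WX" and Y_mem: "Y i \<in> ?WY" for i by (auto intro: words.base)
  have stable: "br x w \<in> ?T" if "w \<in> ?T" for x w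
  proof (rule A.stable_generated[OF generates subspace_span _ that], intro conjI ballI)
    fix g assume g: "g \<in> range H \<union> range X \<union> range Y"
    then show "\<exists>a. g \<in> gr a" using H_even X_gr Y_gr by blast
    fix w assume w: "w \<in> ?T"
    show "br g w \<in> ?T"
    proof (rule A.span_act[OF _ w])
      fix w assume w: "w \<in> range H \<union> ?WX \<union> ?WY"
      consider (H) x where "g = H x" | (X) i where "g = X i" | (Y) i where "g = Y i" using g by blast
      then show "br g w \<in> ?T"
      proof cases
        case H
        have "w \<in> A.Wt (\<lambda>_. 0)" if "w \<in> range H" using that by (auto simp: weight_space_def H_H)
        then have "\<exists>\<mu>. w \<in> A.Wt \<mu>" using w WX WY by blast
        then obtain c where "br g w = gscale c w" by (auto simp: weight_space_def H)
        then show ?thesis using w by (metis span_base span_scale)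
      next
        case X
        consider (H) x where "w = H x" | (X) "w \<in> ?WX" | (Y) "w \<in> ?WY" using w by blast
        then show ?thesis
        proof cases
          case H
          show ?thesis unfolding H X X_H using X_mem by (intro span_scale span_base) blast
        next
          case X': X
          show ?thesis unfolding X using words.step[OF X', of i] by (auto intro: span_base)
        next
          case Y
          show ?thesis unfolding X using WY[OF Y, of i] sub by blast
        qed
      next
        case Y
        consider (H) x where "w = H x" | (X) "w \<in> ?WX" | (Y) "w \<in> ?WY" using w by blast
        then show ?thesis
        proof cases
          case H
          show ?thesis unfolding H Y Y_H using Y_mem by (intro span_scale span_base) blast
        next
          case X
          show ?thesis unfolding Y using WX[OF X, of i] sub by blast
        next
          case Y': Y
          show ?thesis unfolding Y using words.step[OF Y', of i] by (auto intro: span_base)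
        qed
      qed
    qed
  qed
  have "generated_subalgebra gscale br (range H \<union> range X \<union> range Y) \<subseteq> ?T"
    unfolding generated_subalgebra_def
    by (rule Inter_lower) (use stable X_mem Y_mem in \<open>auto intro: span_base\<close>)
  then show ?thesis using generates by auto
qed

text \<open>Every member of the spanning set in \<open>triangular\<close> other than
  \<open>X k\<close> has a weight different from \<open>a k\<close>, so independence of weights
  kills \<open>x\<close> minus its component along \<open>X k\<close>.\<close>

lemma X_root_space:
  assumes "x \<in> root_space gscale br H (a k)"
  shows "\<exists>c. x = gscale c (X k)"
proof -
  interpret A: chev_module hscale gscale gr br H q h a X Y gscale gr br by (rule adjoint_module)
  interpret F: chev_system hscale gscale gr br H q
   "\<lambda>i. hscale (- super_sign (q i) (q i)) (h i)" "\<lambda>i x. - a i x" Y X by (rule flip)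
  let ?WX = "words (\<lambda>i. br (X i)) (range X)" and ?WY = "words (\<lambda>i. br (Y i)) (range Y)"
  let ?R = "range H \<union> (?WX - {X k}) \<union> ?WY"
  have Wt: "A.Wt = root_space gscale br H" by (simp add: root_space_def weight_space_def fun_eq_iff)
  have "x \<in> span (insert (X k) ?R)"
    using triangular span_mono[of "range H \<union> ?WX \<union> ?WY" "insert (X k) ?R"] by blast
  then obtain c where c: "x - gscale c (X k) \<in> span ?R"
    by (auto simp: span_insert)
  have R: "\<exists>\<nu>. \<nu> \<noteq> a k \<and> w \<in> A.Wt \<nu>" if w: "w \<in> ?R" for w
  proof -
    consider (H) "w \<in> range H" | (X) "w \<in> ?WX" "w \<noteq> X k" | (Y) "w \<in> ?WY" using w by blast
    then show ?thesis
    proof cases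
      case H
      have "\<exists>z. a k z \<noteq> 0"
        using a_independent[of "\<lambda>i. if i = k then 1 else 0" k] a_eq_sum[of k] by auto
      then have "(\<lambda>_. 0) \<noteq> a k" by (metis)
      moreover have "w \<in> A.Wt (\<lambda>_. 0)" using H by (auto simp: H_H weight_space_def)
      ultimately show ?thesis by blast
    next
      case X
      from X_words_weight[OF X(1)] obtain n :: "'n \<Rightarrow> nat" where
        n: "w \<in> A.Wt (\<lambda>z. \<Sum>i\<in>UNIV. of_nat (n i) * a i z)"
          "sum n UNIV \<ge> 2 \<or> (\<exists>k. n = (\<lambda>i. if i = k then 1 else 0) \<and> w = X k)"
        unfolding Wt by (elim exE conjE)
      have "(\<lambda>z. \<Sum>i\<in>UNIV. of_nat (n i) * a i z) \<noteq> a k"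
      proof
        assume "(\<lambda>z. \<Sum>i\<in>UNIV. of_nat (n i) * a i z) = a k"
        then have "(\<Sum>i\<in>UNIV. of_nat (n i) * a i z) = (\<Sum>j\<in>UNIV. (if j = k then 1 else 0) * a j z)" for z
          by (metis a_eq_sum)
        then have "(\<lambda>i. of_nat (n i) :: complex) = (\<lambda>j. if j = k then 1 else 0)" by (rule weight_eq_imp)
        then have eq: "n = (\<lambda>j. if j = k then 1 else 0)"
          by (auto simp: fun_eq_iff split: if_splits dest: spec)
        then have "sum n UNIV = 1" by simp
        then obtain k' where k': "n = (\<lambda>i. if i = k' then 1 else 0)" "w = X k'" using n(2) by fastforce
        then have "n k' = 1" by simp
        then have "k' = k" using eq by (simp split: if_splits)
        with k' X(2) show False by simp
      qed
      then show ?thesis using n(1) by blast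
    next
      case Y
      from F.X_words_weight[OF Y] obtain n :: "'n \<Rightarrow> nat" where
        n: "w \<in> A.Wt (\<lambda>z. \<Sum>i\<in>UNIV. of_nat (n i) * - a i z)"
        unfolding Wt by (elim exE conjE)
      \<comment> \<open>Equality would require the coefficient \<open>- of_nat (n k)\<close> to be
        1.\<close>
      have "(\<lambda>z. \<Sum>i\<in>UNIV. of_nat (n i) * - a i z) \<noteq> a k"
      proof
        assume "(\<lambda>z. \<Sum>i\<in>UNIV. of_nat (n i) * - a i z) = a k"
        then have "(\<Sum>i\<in>UNIV. - of_nat (n i) * a i z) = (\<Sum>j\<in>UNIV. (if j = k then 1 else 0) * a j z)" for z
          by (metis (no_types, lifting) a_eq_sum minus_mult_commute sum.cong)
        then have "(\<lambda>i. - of_nat (n i) :: complex) = (\<lambda>j. if j = k then 1 else 0)" by (rule weight_eq_imp)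
        then have "- of_nat (n k) = (1::complex)" by (auto dest: fun_cong[of _ _ k])
        then have "1 + of_nat (n k) = (0::complex)" by (metis add.commute add.right_inverse minus_minus)
        then have "(of_nat (Suc (n k)) :: complex) = 0" by simp
        then show False unfolding of_nat_eq_0_iff by simp
      qed
      then show ?thesis using n(1) by blast
    qed
  qed
  have "x - gscale c (X k) = 0"
  proof (rule weight_space_span_eq_0[OF br_linear_right])
    show "x - gscale c (X k) \<in> span (\<Union>\<nu>\<in>-{a k}. A.Wt \<nu>)"
      using c span_mono[of ?R "\<Union>\<nu>\<in>-{a k}. A.Wt \<nu>"] R by blast
    show "x - gscale c (X k) \<in> A.Wt (a k)"
      using assms X_root[of k] A.subspace_weight_space[of H "a k"] unfolding Wt
      by (simp add: subspace_diff subspace_scale)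
  qed simp
  then show ?thesis by auto
qed

lemma Y_root_space:
  assumes "y \<in> root_space gscale br H (\<lambda>x. - a k x)"
  shows "\<exists>c. y = gscale c (Y k)"
  using chev_system.X_root_space[OF flip assms] .

end

section \<open>Reflections of Chevalley generators\<close>

definition refl_par :: "('n \<Rightarrow> bit) \<Rightarrow> 'n \<Rightarrow> 'n \<Rightarrow> bit" where
  "refl_par q k i = (if i = k then q k else q i + q k)"

text \<open>One formula for both kinds of reflection, valid when \<open>a k\<close> is added once to
  every other simple root: at an even root with Cartan integers -1, and at an isotropic odd root
  with nonzero entries.\<close>

definition refl_root :: "('n \<Rightarrow> 'h \<Rightarrow> complex) \<Rightarrow> 'n \<Rightarrow> 'n \<Rightarrow> 'h \<Rightarrow> complex" where
  "refl_root a k i x = (if i = k then - a k x else a i x + a k x)"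

text \<open>The coroot that arises from bracketing the new root vectors, see \<open>XX_YY\<close>;
  it is left unnormalised, as rows matter only up to scaling.\<close>

definition refl_coroot :: "(complex \<Rightarrow> 'h::ab_group_add \<Rightarrow> 'h) \<Rightarrow> ('n \<Rightarrow> 'h \<Rightarrow> complex) \<Rightarrow> ('n \<Rightarrow> 'h) \<Rightarrow> 'n \<Rightarrow> 'n \<Rightarrow> 'h" where
  "refl_coroot hscale a h k i =
     (if i = k then h k else hscale (a i (h k)) (h i) + hscale (a k (h i)) (h k))"

context lie_superalgebra
begin

lemma generated_base: "s \<in> S \<Longrightarrow> s \<in> generated_subalgebra sc br S"
  by (auto simp: generated_subalgebra_def)

lemma generated_br:
  "x \<in> generated_subalgebra sc br S \<Longrightarrow> y \<in> generated_subalgebra sc br S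
    \<Longrightarrow> br x y \<in> generated_subalgebra sc br S"
  by (auto simp: generated_subalgebra_def)

lemma generated_scale:
  "x \<in> generated_subalgebra sc br S \<Longrightarrow> sc c x \<in> generated_subalgebra sc br S"
  by (auto simp: generated_subalgebra_def subspace_scale)

lemma subspace_generated: "subspace (generated_subalgebra sc br S)"
  by (auto simp: generated_subalgebra_def intro!: subspace_Inter)

lemma generated_mono:
  assumes "S \<subseteq> generated_subalgebra sc br T"
  shows "generated_subalgebra sc br S \<subseteq> generated_subalgebra sc br T"
  using assms subspace_generated[of T] generated_br[of _ T]
  unfolding generated_subalgebra_def[of sc br S] by (intro Inter_lower) auto

lemma br_br:
  assumes "x \<in> gr a" "y \<in> gr b"
  shows "br (br x y) z = br x (br y z) - sc (super_sign a b) (br y (br x z))"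
  using jacobi[OF assms, of z] by simp

lemma double_eq_0: "x = - x \<Longrightarrow> x = 0" for x :: 'g
proof -
  assume "x = - x"
  then have "sc 2 x = 0" by (metis add.right_inverse mult_2 one_add_one scale_left_distrib scale_one)
  then show "x = 0" by simp
qed

end

section \<open>Serre relations and reflected generators\<close>

context chev_system
begin

lemma br_root:
  assumes "x \<in> root_space gscale br H \<beta>" "y \<in> root_space gscale br H \<gamma>"
  shows "br x y \<in> root_space gscale br H (\<lambda>z. \<gamma> z + \<beta> z)"
proof -
  interpret A: chev_module hscale gscale gr br H q h a X Y gscale gr br by (rule adjoint_module)
  show ?thesis
    using A.act_weight[OF H_even assms(1), of y \<gamma>] assms(2) by (simp add: root_space_def weight_space_def)
qed

lemma sum_if2:
  assumes "i \<noteq> k"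
  shows "(\<Sum>j\<in>UNIV. of_nat (if j = k then 2 else if j = i then m else 0) * a j z) = 2 * a k z + of_nat m * a i z"
proof -
  have "(\<Sum>j\<in>UNIV. of_nat (if j = k then 2 else if j = i then m else 0) * a j z)
    = (\<Sum>j\<in>UNIV. (if j = k then 2 * a k z else 0) + (if j = i then of_nat m * a i z else 0))"
    by (intro sum.cong refl) (use assms in auto)
  then show ?thesis by (simp add: sum.distrib)
qed

text \<open>Applying \<open>Y k\<close> produces the factor \<open>a k (h k) = 0\<close>, and the
  other \<open>Y j\<close> have zero bracket with \<open>X k\<close>; so
  \<open>positive_singular_eq_0\<close> applies.\<close>

lemma serre_odd:
  assumes "q k = 1" "a k (h k) = 0"
  shows "br (X k) (X k) = 0"
proof (rule positive_singular_eq_0[where n="\<lambda>i. if i = k then 2 else 0" and k=k])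
  show "br (X k) (X k) \<in> gr (q k + q k)" by (rule br_graded[OF X_gr X_gr])
  have "(\<Sum>i\<in>UNIV. of_nat (if i = k then 2 else 0) * a i z) = a k z + a k z" for z
    by (simp add: if_distrib[of "\<lambda>c. of_nat c * _"] cong: if_cong)
  then show "br (X k) (X k) \<in> root_space gscale br H (\<lambda>z. \<Sum>i\<in>UNIV. of_nat (if i = k then 2 else 0) * a i z)"
    using br_root[OF X_root X_root, of k k] by simp
  show "br (Y j) (br (X k) (X k)) = 0" for j
    using jacobi[OF Y_gr X_gr, of j k "X k"]
    by (auto simp: Y_X br_simps assms H_X X_H)
qed auto

text \<open>As \<open>X k\<close> is odd with \<open>br (X k) (X k) = 0\<close>, the Jacobi identity
  equates the element with its own negative.\<close>

lemma serre_odd2: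
  assumes "q k = 1" "a k (h k) = 0"
  shows "br (X k) (br (X k) y) = 0"
  using jacobi[OF X_gr X_gr, of k k y] assms
  by (simp add: serre_odd br_simps double_eq_0)

text \<open>The Cartan integer is -1: applying \<open>Y k\<close> gives the factor
  \<open>a k (h k) + 2 * a i (h k) = 0\<close>, and applying \<open>Y i\<close> leads to
  \<open>br (X k) (X k) = 0\<close>.\<close>

lemma serre_even:
  assumes "q k = 0" "a i (h k) = - a k (h k) / 2" "i \<noteq> k"
  shows "br (X k) (br (X k) (X i)) = 0"
proof (rule positive_singular_eq_0[where n="\<lambda>j. if j = k then 2 else if j = i then 1 else 0" and k=k])
  show "br (X k) (br (X k) (X i)) \<in> gr (q k + (q k + q i))"
    by (intro br_graded X_gr)
  show "br (X k) (br (X k) (X i)) \<in> root_space gscale br H (\<lambda>z. \<Sum>j\<in>UNIV. of_nat (if j = k then 2 else if j = i then 1 else 0) * a j z)"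
    using br_root[OF X_root br_root[OF X_root X_root], of k k i] unfolding sum_if2[OF assms(3)]
    by (simp add: algebra_simps)
  have XX: "br (X k) (X k) = 0"
    using antisym_even[of "X k" "X k"] X_gr[of k] by (simp add: assms double_eq_0)
  show "br (Y j) (br (X k) (br (X k) (X i))) = 0" for j
  proof -
    have 1: "br (Y j) (br (X k) z) = (if j = k then - br (H (h k)) z else 0) + br (X k) (br (Y j) z)" for z
      using jacobi[OF Y_gr X_gr, of j k z] by (simp add: assms Y_X br_simps)
    have 2: "br (H (h k)) (br (X k) (X i)) = gscale (a k (h k) + a i (h k)) (br (X k) (X i))"
      using br_root[OF X_root X_root, of k i] by (simp add: root_space_def add.commute)
    show ?thesis
      using assms(3)
      by (auto simp: 1 2 Y_X H_X X_H br_simps XX assms(2) scale_minus_left[symmetric] scale_left_distrib[symmetric]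
        simp del: scale_minus_left)
  qed
qed auto

definition refl_X :: "'n \<Rightarrow> 'n \<Rightarrow> 'g" where
  "refl_X k i = (if i = k then Y k else br (X k) (X i))"

text \<open>The signs make \<open>br (refl_X k i) (refl_Y k i)\<close> equal to \<open>H\<close> of
  \<open>refl_coroot\<close> without a further factor.\<close>

definition refl_Y :: "'n \<Rightarrow> 'n \<Rightarrow> 'g" where
  "refl_Y k i = (if i = k then gscale (- super_sign (q k) (q k)) (X k)
     else gscale (super_sign (q k) (q i)) (br (Y k) (Y i)))"

lemma Y_X_X: "i \<noteq> k \<Longrightarrow> br (Y k) (br (X k) (X i)) = gscale (- super_sign (q k) (q k) * a i (h k)) (X i)"
  using jacobi[OF Y_gr X_gr, of k k "X i"] by (simp add: Y_X br_simps H_X)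

lemma X_Y_Y: "i \<noteq> k \<Longrightarrow> br (X k) (br (Y k) (Y i)) = gscale (- a i (h k)) (Y i)"
  using jacobi[OF X_gr Y_gr, of k k "Y i"] by (simp add: X_Y br_simps H_Y)

lemma XX_YY:
  assumes "i \<noteq> k" "j \<noteq> k"
  shows "br (br (X k) (X i)) (br (Y k) (Y j)) =
    (if i = j then gscale (super_sign (q k) (q i))
       (H (hscale (a i (h k)) (h i) + hscale (a k (h i)) (h k))) else 0)"
proof -
  let ?Z = "br (X k) (X i)"
  have Z: "?Z \<in> gr (q k + q i)" by (rule br_graded[OF X_gr X_gr])
  have ZYk: "br ?Z (Y k) = gscale (super_sign (q k) (q i) * a i (h k)) (X i)"
    using assms by (simp add: br_br[OF X_gr X_gr] X_Y X_H br_simps)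
  have ZYj: "br ?Z (Y j) = (if i = j then gscale (- a k (h i)) (X k) else 0)"
    using assms by (auto simp: br_br[OF X_gr X_gr] X_Y X_H br_simps)
  \<comment> \<open>The sign is multiplicative in each argument, so the factors at
    \<open>q k\<close> cancel.\<close>
  have s: "super_sign (q k + q i) (q k) * super_sign (q k) (q k) = super_sign (q k) (q i)"
    by (cases "q k"; cases "q i") (simp_all add: super_sign_def)
  have "br ?Z (br (Y k) (Y j)) = br (br ?Z (Y k)) (Y j) + gscale (super_sign (q k + q i) (q k)) (br (Y k) (br ?Z (Y j)))"
    by (rule jacobi[OF Z Y_gr])
  also have "\<dots> = (if i = j then gscale (super_sign (q k) (q i) * a i (h k)) (H (h i))
      + gscale (super_sign (q k + q i) (q k) * super_sign (q k) (q k) * a k (h i)) (H (h k)) else 0)"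
    using assms by (auto simp: ZYk ZYj br_simps X_Y Y_X mult_ac)
  finally show ?thesis
    unfolding s by (simp add: lin_add[OF H_linear] lin_scale[OF H_linear] scale_right_distrib)
qed

text \<open>\<open>SX\<close> and \<open>SY\<close> make the mixed brackets vanish. By
  \<open>nz\<close>, bracketing back with \<open>Y k\<close> and \<open>X k\<close> gives nonzero
  multiples of the old generators, so the new ones generate too.\<close>

lemma reflect:
  assumes nz: "\<And>i. i \<noteq> k \<Longrightarrow> a i (h k) \<noteq> 0"
    and SX: "\<And>i. i \<noteq> k \<Longrightarrow> br (X k) (br (X k) (X i)) = 0"
    and SY: "\<And>i. i \<noteq> k \<Longrightarrow> br (Y k) (br (Y k) (Y i)) = 0"
  shows "chev_system hscale gscale gr br H (refl_par q k) (refl_coroot hscale a h k) (refl_root a k)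
    (refl_X k) (refl_Y k)"
proof (intro chev_system.intro chev_system_axioms.intro cartan_axioms)
  show "Vector_Spaces.linear hscale (*) (refl_root a k i)" for i
    using a_linear[of i] a_linear[of k] unfolding Vector_Spaces.linear_iff refl_root_def
    by (auto simp: algebra_simps)
next
  fix c i assume c: "\<And>x. (\<Sum>i\<in>UNIV. c i * refl_root a k i x) = 0"
  \<comment> \<open>The coefficients of the same combination in the old base: each new root with
    \<open>i \<noteq> k\<close> contributes one \<open>a k\<close>, and the \<open>k\<close>-th one
    is \<open>- a k\<close>.\<close>
  define d where "d i = (if i = k then (\<Sum>j\<in>-{k}. c j) - c k else c i)" for i
  have "(\<Sum>i\<in>UNIV. d i * a i x) = (\<Sum>i\<in>UNIV. c i * refl_root a k i x)" for x
  proof -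
    have "(\<Sum>i\<in>UNIV. d i * a i x) = d k * a k x + (\<Sum>i\<in>-{k}. d i * a i x)"
      by (simp add: sum.remove[of UNIV k] Compl_eq_Diff_UNIV)
    also have "\<dots> = - c k * a k x + (\<Sum>i\<in>-{k}. c i * (a i x + a k x))"
      by (simp add: d_def algebra_simps sum.distrib sum_distrib_left)
    also have "\<dots> = (\<Sum>i\<in>UNIV. c i * refl_root a k i x)"
      by (simp add: sum.remove[of UNIV k] Compl_eq_Diff_UNIV refl_root_def)
    finally show ?thesis .
  qed
  then have d: "d j = 0" for j using a_independent[of d j] c by simp
  have c0: "c j = 0" if "j \<noteq> k" for j using d[of j] that by (simp add: d_def)
  then show "c i = 0" using d[of k] by (cases "i = k") (simp_all add: d_def)
next
  show "refl_X k i \<in> root_space gscale br H (refl_root a k i)" for i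
    using Y_root[of k] br_root[OF X_root X_root, of k i]
    by (auto simp: refl_X_def refl_root_def[abs_def])
  have Sc: "gscale c x \<in> root_space gscale br H \<beta>" if "x \<in> root_space gscale br H \<beta>" for c x \<beta>
    using that by (auto simp: root_space_def br_simps mult.commute)
  show "refl_Y k i \<in> root_space gscale br H (\<lambda>x. - refl_root a k i x)" for i
    using Sc[OF X_root[of k]] Sc[OF br_root[OF Y_root Y_root, of k i]]
    by (cases "i = k") (simp_all add: refl_Y_def refl_root_def[abs_def] algebra_simps del: scale_minus_left)
  show "refl_X k i \<in> gr (refl_par q k i)" for i
    using Y_gr[of k] br_graded[OF X_gr X_gr, of k i] unfolding refl_X_def refl_par_def by (metis add.commute)
  show "refl_Y k i \<in> gr (refl_par q k i)" for i
    using X_gr[of k] br_graded[OF Y_gr Y_gr, of k i]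
    unfolding refl_Y_def refl_par_def by (metis add.commute gr_scale)
  show "br (refl_X k i) (refl_Y k j) = (if i = j then H (refl_coroot hscale a h k i) else 0)" for i j
  proof (cases "i = k"; cases "j = k")
    assume "i = k" "j = k"
    then show ?thesis by (simp add: refl_X_def refl_Y_def refl_coroot_def br_simps Y_X)
  next
    assume "i = k" "j \<noteq> k"
    then show ?thesis by (simp add: refl_X_def refl_Y_def br_simps SY)
  next
    assume "i \<noteq> k" "j = k"
    then show ?thesis
      using br_super_antisym[OF br_graded[OF X_gr X_gr] X_gr, of k i k]
      by (simp add: refl_X_def refl_Y_def br_simps SX)
  next
    assume "i \<noteq> k" "j \<noteq> k"
    then show ?thesis
      by (auto simp: refl_X_def refl_Y_def br_simps XX_YY refl_coroot_def)
  qed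
  let ?S = "range H \<union> range (refl_X k) \<union> range (refl_Y k)"
  let ?G = "generated_subalgebra gscale br ?S"
  have rX: "refl_X k i \<in> ?G" and rY: "refl_Y k i \<in> ?G" for i by (auto intro: generated_base)
  have Yk: "Y k \<in> ?G" using rX[of k] by (simp add: refl_X_def)
  have Xk: "X k \<in> ?G" using generated_scale[OF rY[of k], of "- super_sign (q k) (q k)"] by (simp add: refl_Y_def)
  have Xi: "X i \<in> ?G" for i
  proof (cases "i = k")
    case False
    have "gscale (- super_sign (q k) (q k) / a i (h k)) (br (Y k) (refl_X k i)) \<in> ?G"
      by (intro generated_scale generated_br Yk rX)
    then show ?thesis using False nz[of i] by (simp add: refl_X_def Y_X_X)
  qed (use Xk in simp)
  have Yi: "Y i \<in> ?G" for i
  proof (cases "i = k")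
    case False
    have "gscale (- super_sign (q k) (q i) / a i (h k)) (br (X k) (refl_Y k i)) \<in> ?G"
      by (intro generated_scale generated_br Xk rY)
    then show ?thesis using False nz[of i] by (simp add: refl_Y_def X_Y_Y br_simps)
  qed (use Yk in simp)
  have "generated_subalgebra gscale br (range H \<union> range X \<union> range Y) \<subseteq> ?G"
    by (rule generated_mono) (use Xi Yi in \<open>auto intro: generated_base\<close>)
  then show "?G = UNIV" using generates by auto
qed

lemma refl_nonzero:
  assumes nz: "\<And>i. i \<noteq> k \<Longrightarrow> a i (h k) \<noteq> 0" and "\<And>i. X i \<noteq> 0" "\<And>i. Y i \<noteq> 0"
  shows "refl_X k i \<noteq> 0" "refl_Y k i \<noteq> 0"
proof -
  have s: "super_sign b c \<noteq> 0" for b c by (simp add: super_sign_def)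
  show "refl_X k i \<noteq> 0"
    using Y_X_X[of i k] assms s by (auto simp: refl_X_def br_simps)
  show "refl_Y k i \<noteq> 0"
    using X_Y_Y[of i k] assms s by (auto simp: refl_Y_def br_simps)
qed

end

text \<open>Simple root spaces are spanned by one vector, so the two choices of root vectors are
  proportional; hence parities agree and rows differ by a scalar.\<close>

lemma chev_system_unique:
  assumes "chev_system hscale gscale gr br H q h a X Y"
    and "chev_system hscale gscale gr br H q' h' a X' Y'"
    and nz: "\<And>i. X i \<noteq> 0" "\<And>i. Y i \<noteq> 0"
  shows "X' i \<noteq> 0" "Y' i \<noteq> 0" "q' i = q i" "\<exists>c. c \<noteq> 0 \<and> (\<forall>j. a j (h' i) = c * a j (h i))"
proof -
  interpret A: chev_system hscale gscale gr br H q h a X Y by fact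
  interpret B: chev_system hscale gscale gr br H q' h' a X' Y' by fact
  obtain c where c: "X i = gscale c (X' i)" using B.X_root_space[OF A.X_root] by blast
  obtain d where d: "Y i = gscale d (Y' i)" using B.Y_root_space[OF A.Y_root] by blast
  have cd: "c \<noteq> 0" "d \<noteq> 0" using c d nz[of i] by auto
  show "X' i \<noteq> 0" "Y' i \<noteq> 0" using c d nz[of i] by auto
  show "q' i = q i"
    using A.gr_unique[OF A.X_gr[of i], of "q' i"] c A.gr_scale[OF B.X_gr[of i], of c] nz[of i] by metis
  have H: "H (h i) = gscale (c * d) (H (h' i))"
    using A.X_Y[of i i] B.X_Y[of i i] by (simp add: c d A.br_simps mult.commute)
  \<comment> \<open>Read off from the action on the nonzero \<open>X j\<close>, since
    \<open>H\<close> is not known to be injective.\<close>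
  have "a j (h i) = (c * d) * a j (h' i)" for j
  proof -
    have "gscale (a j (h i)) (X j) = br (H (h i)) (X j)" by (simp only: A.H_X)
    also have "\<dots> = gscale (c * d) (br (H (h' i)) (X j))" by (simp only: H A.br_simps)
    also have "\<dots> = gscale ((c * d) * a j (h' i)) (X j)" by (simp only: A.H_X A.scale_scale)
    finally have "gscale (a j (h i)) (X j) = gscale ((c * d) * a j (h' i)) (X j)" .
    then show ?thesis using nz[of j] by (metis A.scale_right_imp_eq)
  qed
  then show "\<exists>c. c \<noteq> 0 \<and> (\<forall>j. a j (h' i) = c * a j (h i))"
    using cd by (intro exI[of _ "1 / (c * d)"]) simp
qed

section \<open>Weights of irreducible highest weight modules\<close>

definition weights :: "('h \<Rightarrow> 'g) \<Rightarrow> (complex \<Rightarrow> 'v::ab_group_add \<Rightarrow> 'v) \<Rightarrow> ('g \<Rightarrow> 'v \<Rightarrow> 'v) \<Rightarrow> ('h \<Rightarrow> complex) set" where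
  "weights H vscale act = {\<phi>. \<exists>w\<in>weight_space H vscale act \<phi>. w \<noteq> 0}"

definition locally_nilpotent :: "('v::ab_group_add \<Rightarrow> 'v) \<Rightarrow> bool" where
  "locally_nilpotent T \<longleftrightarrow> (\<forall>v. \<exists>N. (T ^^ N) v = 0)"

context chev_system
begin

lemma weight_cone_antisym:
  assumes "\<phi> \<in> weight_cone a \<mu>" "\<mu> \<in> weight_cone a \<phi>"
  shows "\<phi> = \<mu>"
proof -
  obtain n m :: "'n \<Rightarrow> nat" where n: "\<phi> = (\<lambda>x. \<mu> x - (\<Sum>i\<in>UNIV. of_nat (n i) * a i x))"
    and m: "\<mu> = (\<lambda>x. \<phi> x - (\<Sum>i\<in>UNIV. of_nat (m i) * a i x))"
    using assms unfolding weight_cone_def by blast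
  have "(\<Sum>i\<in>UNIV. of_nat (n i + m i) * a i x) = 0" for x
  proof -
    have "(\<Sum>i\<in>UNIV. of_nat (n i) * a i x) + (\<Sum>i\<in>UNIV. of_nat (m i) * a i x) = 0"
      using fun_cong[OF n, of x] fun_cong[OF m, of x] by algebra
    then show ?thesis by (simp add: ring_distribs sum.distrib)
  qed
  then have "(of_nat (n i + m i) :: complex) = 0" for i by (rule a_independent)
  then have "n i + m i = 0" for i unfolding of_nat_eq_0_iff .
  then show ?thesis using n by simp
qed

text \<open>In the cone, the \<open>k\<close>-th coordinate of \<mu> minus the weight is a natural
  number, and each step along \<open>\<beta>\<close> lowers it by \<open>z\<close>. This is the
  source of local nilpotency.\<close>

lemma weight_cone_bounded:
  assumes \<beta>: "\<And>x. \<beta> x = (\<Sum>i\<in>UNIV. c i * a i x)" and c: "c k = of_int z" "z > 0"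
  shows "\<exists>N. (\<lambda>x. \<psi> x + of_nat N * \<beta> x) \<notin> weight_cone a \<mu>"
proof (rule ccontr)
  assume "\<not> ?thesis"
  then have "\<forall>N. \<exists>n::'n \<Rightarrow> nat. (\<lambda>x. \<psi> x + of_nat N * \<beta> x) = (\<lambda>x. \<mu> x - (\<Sum>i\<in>UNIV. of_nat (n i) * a i x))"
    by (auto simp: weight_cone_def)
  then obtain n :: "nat \<Rightarrow> 'n \<Rightarrow> nat" where
    n: "\<And>N. (\<lambda>x. \<psi> x + of_nat N * \<beta> x) = (\<lambda>x. \<mu> x - (\<Sum>i\<in>UNIV. of_nat (n N i) * a i x))"
    by metis
  \<comment> \<open>One step more than the coordinate at the start of the string allows.\<close>
  define N where "N = Suc (n 0 k)"
  have "(\<Sum>i\<in>UNIV. (of_nat N * c i) * a i x) = (\<Sum>i\<in>UNIV. (of_nat (n 0 i) - of_nat (n N i)) * a i x)" for x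
  proof -
    have "\<psi> x = \<mu> x - (\<Sum>i\<in>UNIV. of_nat (n 0 i) * a i x)" using fun_cong[OF n[of 0], of x] by simp
    then have "of_nat N * \<beta> x = (\<Sum>i\<in>UNIV. of_nat (n 0 i) * a i x) - (\<Sum>i\<in>UNIV. of_nat (n N i) * a i x)"
      using fun_cong[OF n[of N], of x] by algebra
    then show ?thesis by (simp add: \<beta> sum_distrib_left sum_subtractf left_diff_distrib mult.assoc)
  qed
  then have "(\<lambda>i. of_nat N * c i) = (\<lambda>i. of_nat (n 0 i) - of_nat (n N i))" by (rule weight_eq_imp)
  then have "of_nat N * c k = of_nat (n 0 k) - of_nat (n N k)" by (rule fun_cong)
  then have "(of_int (int N * z) :: complex) = of_int (int (n 0 k) - int (n N k))" by (simp add: c)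
  then have "int N * z = int (n 0 k) - int (n N k)" unfolding of_int_eq_iff .
  moreover have "int N * z \<ge> int N" using c(2) by (simp add: mult_le_cancel_left1)
  ultimately show False by (simp add: N_def)
qed

end

section \<open>\<open>sl(2)\<close> theory for an even simple root\<close>

context chev_module
begin

lemma act_pow_weight:
  assumes "x \<in> root_space gscale br H \<beta>" "w \<in> Wt \<phi>"
  shows "(act x ^^ N) w \<in> Wt (\<lambda>z. \<phi> z + of_nat N * \<beta> z)"
proof (induction N)
  case (Suc N)
  show ?case using act_weight[OF H_even assms(1) Suc] by (simp add: algebra_simps)
qed (use assms in simp)

lemma X_pow_weight: "w \<in> Wt \<phi> \<Longrightarrow> (act (X k) ^^ N) w \<in> Wt (\<lambda>z. \<phi> z + of_nat N * a k z)"
  by (rule act_pow_weight[OF X_root])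

lemma Y_pow_weight: "w \<in> Wt \<phi> \<Longrightarrow> (act (Y k) ^^ N) w \<in> Wt (\<lambda>z. \<phi> z - of_nat N * a k z)"
  using act_pow_weight[OF Y_root, of w \<phi> N k] by simp

lemma X_Y_pow:
  assumes "q k = 0" "a k (h k) = 2" "u \<in> Wt \<phi>" "act (X k) u = 0"
  shows "act (X k) ((act (Y k) ^^ Suc j) u) =
    vscale (of_nat (Suc j) * (\<phi> (h k) - of_nat j)) ((act (Y k) ^^ j) u)"
proof (induction j)
  case 0
  then show ?case
    using act_act[OF X_gr Y_gr, of k k u] assms by (simp add: X_Y weight_space_def act_simps)
next
  case (Suc j)
  let ?y = "\<lambda>j. (act (Y k) ^^ j) u"
  have "?y (Suc j) \<in> Wt (\<lambda>z. \<phi> z - of_nat (Suc j) * a k z)" by (rule Y_pow_weight[OF assms(3)])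
  then have "act (H (h k)) (?y (Suc j)) = vscale (\<phi> (h k) - of_nat (Suc j) * 2) (?y (Suc j))"
    using assms(2) by (simp add: weight_space_def)
  moreover have "act (X k) (?y (Suc (Suc j))) = act (H (h k)) (?y (Suc j)) + act (Y k) (act (X k) (?y (Suc j)))"
    using act_act[OF X_gr Y_gr, of k k "?y (Suc j)"] assms(1) by (simp add: X_Y)
  ultimately have "act (X k) (?y (Suc (Suc j))) =
    vscale (\<phi> (h k) - of_nat (Suc j) * 2 + of_nat (Suc j) * (\<phi> (h k) - of_nat j)) (?y (Suc j))"
    unfolding Suc.IH by (simp only: act_simps V.scale_left_distrib) simp
  moreover have "\<phi> (h k) - of_nat (Suc j) * 2 + of_nat (Suc j) * (\<phi> (h k) - of_nat j)
     = of_nat (Suc (Suc j)) * (\<phi> (h k) - of_nat (Suc j))"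
    by (simp add: algebra_simps)
  ultimately show ?case by simp
qed

text \<open>At the least vanishing power \<open>Suc m\<close>, \<open>X_Y_pow\<close> forces
  \<open>\<phi> (h k) = of_nat m\<close>. The nonzero lower powers supply the weights used for
  reflection.\<close>

lemma singular_nilpotent:
  assumes "q k = 0" "a k (h k) = 2" "u \<in> Wt \<phi>" "act (X k) u = 0" "u \<noteq> 0"
    and nil: "(act (Y k) ^^ N) u = 0"
  shows "\<exists>m::nat. \<phi> (h k) = of_nat m \<and> (\<forall>j\<le>m. (act (Y k) ^^ j) u \<noteq> 0)"
proof -
  define M where "M = (LEAST N. (act (Y k) ^^ N) u = 0)"
  have M: "(act (Y k) ^^ M) u = 0" unfolding M_def using nil by (rule LeastI)
  have less: "(act (Y k) ^^ j) u \<noteq> 0" if "j < M" for j using that not_less_Least M_def by blast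
  from M assms(5) obtain m where m: "M = Suc m" by (cases M) auto
  have "vscale (of_nat (Suc m) * (\<phi> (h k) - of_nat m)) ((act (Y k) ^^ m) u) = 0"
    unfolding X_Y_pow[OF assms(1-4), symmetric] M[unfolded m] by (rule act_zero_right)
  then have "\<phi> (h k) = of_nat m" using less[of m] unfolding V.scale_eq_0_iff by (simp add: m del: of_nat_Suc)
  then show ?thesis using less m by auto
qed

text \<open>Raising \<open>r\<close> times reaches a singular vector whose string goes down at least
  \<open>m\<close> steps; \<open>m - r\<close> of them lead to the reflected weight. Negative values
  of \<open>\<phi> (h k)\<close> are left to \<open>weights_reflect\<close>.\<close>

lemma weights_reflect_dominant:
  assumes "q k = 0" "a k (h k) = 2"
    and nX: "locally_nilpotent (act (X k))" and nY: "locally_nilpotent (act (Y k))"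
    and \<phi>: "\<phi> \<in> weights H vscale act"
  shows "(\<lambda>z. \<phi> z - \<phi> (h k) * a k z) \<in> weights H vscale act \<or> (\<exists>m::nat. \<phi> (h k) = - of_nat (Suc m))"
proof -
  obtain w where w: "w \<in> Wt \<phi>" "w \<noteq> 0" using \<phi> by (auto simp: weights_def)
  define M where "M = (LEAST N. (act (X k) ^^ N) w = 0)"
  have "(act (X k) ^^ M) w = 0" unfolding M_def
    by (rule LeastI_ex) (use nX in \<open>simp add: locally_nilpotent_def\<close>)
  with w(2) obtain r where M: "M = Suc r" "(act (X k) ^^ Suc r) w = 0" by (cases M) auto
  let ?u = "(act (X k) ^^ r) w"
  have u0: "?u \<noteq> 0" using not_less_Least[of r "\<lambda>N. (act (X k) ^^ N) w = 0"] M by (auto simp: M_def)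
  have uw: "?u \<in> Wt (\<lambda>z. \<phi> z + of_nat r * a k z)" by (rule X_pow_weight[OF w(1)])
  obtain N where "(act (Y k) ^^ N) ?u = 0" using nY unfolding locally_nilpotent_def by blast
  then obtain m :: nat where m: "\<phi> (h k) + of_nat r * a k (h k) = of_nat m"
    "\<And>j. j \<le> m \<Longrightarrow> (act (Y k) ^^ j) ?u \<noteq> 0"
    using singular_nilpotent[OF assms(1,2) uw _ u0] M(2) by auto
  then have \<phi>m: "\<phi> (h k) = of_nat m - of_nat (2 * r)" by (simp add: assms(2) algebra_simps)
  show ?thesis
  proof (cases "m \<ge> 2 * r")
    case True
    then have eq: "\<phi> (h k) = of_nat (m - r) - of_nat r" by (simp add: \<phi>m of_nat_diff)
    have "(act (Y k) ^^ (m - r)) ?u \<in> Wt (\<lambda>z. \<phi> z - \<phi> (h k) * a k z)"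
      using Y_pow_weight[OF uw, of "m - r" k] unfolding eq by (simp add: algebra_simps)
    then show ?thesis using m(2)[of "m - r"] by (auto simp: weights_def)
  next
    case False
    have "\<phi> (h k) = - of_nat (Suc (2 * r - m - 1))"
    proof -
      have "Suc (2 * r - m - 1) = 2 * r - m" using False by simp
      then show ?thesis unfolding \<phi>m using False by (simp add: of_nat_diff del: of_nat_Suc)
    qed
    then show ?thesis by blast
  qed
qed

text \<open>A weight is a mere function; the linear action on a weight vector makes it odd. This
  serves the coroot of the flipped system.\<close>

lemma weight_minus:
  assumes "\<phi> \<in> weights H vscale act" shows "\<phi> (hscale (-1) x) = - \<phi> x"
proof -
  obtain w where w: "w \<in> Wt \<phi>" "w \<noteq> 0" using assms by (auto simp: weights_def)
  have "vscale (\<phi> (hscale (-1) x)) w = act (H (hscale (-1) x)) w"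
    using w by (simp add: weight_space_def)
  also have "\<dots> = vscale (- \<phi> x) w" using w(1)
    by (simp only: lin_scale[OF H_linear] act_simps) (simp add: weight_space_def)
  finally show ?thesis using w(2) by (metis V.scale_right_imp_eq)
qed

text \<open>The flipped system handles negative \<open>\<phi> (h k)\<close>: its reflected weight is
  the same, and its exceptional case would make \<open>- \<phi> (h k)\<close> negative as
  well.\<close>

lemma weights_reflect:
  assumes "q k = 0" "a k (h k) = 2"
    and nX: "locally_nilpotent (act (X k))" and nY: "locally_nilpotent (act (Y k))"
    and \<phi>: "\<phi> \<in> weights H vscale act"
  shows "(\<lambda>z. \<phi> z - \<phi> (h k) * a k z) \<in> weights H vscale act"
proof -
  interpret F: chev_system hscale gscale gr br H q
   "\<lambda>i. hscale (- super_sign (q i) (q i)) (h i)" "\<lambda>i x. - a i x" Y X by (rule flip)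
  interpret F: chev_module hscale gscale gr br H q
   "\<lambda>i. hscale (- super_sign (q i) (q i)) (h i)" "\<lambda>i x. - a i x" Y X vscale vgr act
    by intro_locales
  have "- a k (hscale (- super_sign (q k) (q k)) (h k)) = 2"
    using assms(1,2) lin_scale[OF a_linear, of k "-1" "h k"] by simp
  note F = F.weights_reflect_dominant[OF assms(1) this nY nX \<phi>]
  have e: "\<phi> (hscale (- super_sign (q k) (q k)) (h k)) = - \<phi> (h k)"
    using weight_minus[OF \<phi>, of "h k"] assms(1) by simp
  show ?thesis
  proof (rule disjE[OF weights_reflect_dominant[OF assms]])
    assume "\<exists>m::nat. \<phi> (h k) = - of_nat (Suc m)"
    then obtain m :: nat where m: "\<phi> (h k) = - of_nat (Suc m)" by blast
    have "- \<phi> (h k) \<noteq> - of_nat (Suc m')" for m'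
    proof
      assume "- \<phi> (h k) = - of_nat (Suc m')"
      then have "of_nat (Suc m) = - (of_nat (Suc m') :: complex)" unfolding m minus_minus .
      then have "(of_nat (Suc m + Suc m') :: complex) = 0" by (simp only: of_nat_add) simp
      then show False unfolding of_nat_eq_0_iff by simp
    qed
    then show ?thesis using F unfolding e by simp
  qed
qed

lemma X_nilpotent:
  assumes "weight_module H vscale act" "weights H vscale act \<subseteq> weight_cone a \<mu>"
  shows "locally_nilpotent (act (X k))"
  unfolding locally_nilpotent_def
proof (intro allI, rule nilpotent_weight_generated[OF assms(1)])
  fix \<phi> w assume w: "w \<in> Wt \<phi>"
  obtain N where "(\<lambda>x. \<phi> x + of_nat N * a k x) \<notin> weight_cone a \<mu>"
    using weight_cone_bounded[of "a k", OF a_eq_sum, of k 1] by auto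
  then show "\<exists>N. (act (X k) ^^ N) w = 0"
    using X_pow_weight[OF w, of N k] assms(2) by (auto simp: weights_def)
qed

end

section \<open>Irreducible highest weight modules\<close>

locale irreducible_chev_module = chev_module hscale gscale gr br H q h a X Y vscale vgr act
  for hscale :: "complex \<Rightarrow> 'h::ab_group_add \<Rightarrow> 'h"
    and gscale :: "complex \<Rightarrow> 'g::ab_group_add \<Rightarrow> 'g"
    and gr :: "bit \<Rightarrow> 'g set" and br :: "'g \<Rightarrow> 'g \<Rightarrow> 'g"
    and H :: "'h \<Rightarrow> 'g"
    and q :: "'n::finite \<Rightarrow> bit" and h :: "'n \<Rightarrow> 'h" and a :: "'n \<Rightarrow> 'h \<Rightarrow> complex"
    and X Y :: "'n \<Rightarrow> 'g"
    and vscale :: "complex \<Rightarrow> 'v::ab_group_add \<Rightarrow> 'v"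
    and vgr :: "bit \<Rightarrow> 'v set" and act :: "'g \<Rightarrow> 'v \<Rightarrow> 'v" +
  assumes irreducible: "submodule vscale vgr act W \<Longrightarrow> W = {0} \<or> W = UNIV"
begin

definition hw_vector :: "'v \<Rightarrow> ('h \<Rightarrow> complex) \<Rightarrow> bool" where
  "hw_vector u \<mu> \<longleftrightarrow> u \<noteq> 0 \<and> u \<in> Wt \<mu> \<and> (\<forall>j. act (X j) u = 0)"

text \<open>Prepares for \<open>hw_submodule\<close>, which starts from a homogeneous vector. Each
  \<open>X j\<close> is homogeneous, so it annihilates both components, one of which is
  nonzero.\<close>

lemma hw_homogeneous:
  assumes "hw_vector u \<mu>"
  obtains u' b where "hw_vector u' \<mu>" "u' \<in> vgr b"
proof -
  obtain x y where xy: "x \<in> vgr 0" "y \<in> vgr 1" "u = x + y" by (rule V.gr_cases)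
  have wt: "x \<in> Wt \<mu>" "y \<in> Wt \<mu>"
    using weight_space_gr[OF H_even xy(1,2)] assms by (auto simp: hw_vector_def xy(3))
  have "act (X j) x = 0 \<and> act (X j) y = 0" for j
  proof -
    have "act (X j) x + act (X j) y = 0" using assms by (simp add: hw_vector_def xy(3) act_simps)
    moreover have "act (X j) x \<in> vgr (q j + 0)" "act (X j) y \<in> vgr (q j + 1)"
      by (intro act_graded X_gr xy)+
    moreover have "q j + 0 \<noteq> q j + 1" by simp
    ultimately show ?thesis using V.gr_sum_0 by blast
  qed
  moreover have "x \<noteq> 0 \<or> y \<noteq> 0" using assms xy(3) by (auto simp: hw_vector_def)
  ultimately show ?thesis using that xy wt unfolding hw_vector_def by metis
qed

lemma hw_span:
  assumes "hw_vector u \<mu>"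
  shows "V.span (\<Union>\<nu>\<in>weight_cone a \<mu>. Wt \<nu>) = UNIV"
proof -
  obtain u' b where u': "hw_vector u' \<mu>" "u' \<in> vgr b" by (rule hw_homogeneous[OF assms])
  have wt: "u' \<in> Wt \<mu>" using u'(1) by (simp add: hw_vector_def)
  have "submodule vscale vgr act (V.span (Ywords {u'}))"
    by (rule hw_submodule[OF u'(2) wt]) (use u'(1) in \<open>simp add: hw_vector_def\<close>)
  from irreducible[OF this] have "V.span (Ywords {u'}) = UNIV"
  proof
    assume "V.span (Ywords {u'}) = {0}"
    then show ?thesis
      using V.span_base[OF words.base[of u' "{u'}" "\<lambda>i. act (Y i)"]] u'(1) by (simp add: hw_vector_def)
  qed
  then show ?thesis using words_span[OF wt] by auto
qed

lemma hw_weights: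
  assumes "hw_vector u \<mu>"
  shows "weights H vscale act \<subseteq> weight_cone a \<mu>"
proof
  fix \<phi> assume "\<phi> \<in> weights H vscale act"
  then obtain w where w: "w \<in> Wt \<phi>" "w \<noteq> 0" by (auto simp: weights_def)
  show "\<phi> \<in> weight_cone a \<mu>"
  proof (rule ccontr)
    assume "\<phi> \<notin> weight_cone a \<mu>"
    then show False
      using V.weight_space_span_eq_0[OF act_linear_right _ w(1), where M="weight_cone a \<mu>"] hw_span[OF assms] w(2)
      by simp
  qed
qed

lemma hw_weight_module:
  assumes "hw_vector u \<mu>" shows "weight_module H vscale act"
  using hw_span[OF assms] V.span_mono[of "\<Union>\<nu>\<in>weight_cone a \<mu>. Wt \<nu>" "\<Union>\<nu>. Wt \<nu>"]
  by (auto simp: weight_module_def)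

text \<open>A nonzero \<open>w\<close> would be a highest weight vector too, and then \<phi> and
  \<mu> would each lie in the cone below the other.\<close>

lemma singular_eq_0:
  assumes "hw_vector u \<mu>" "w \<in> Wt \<phi>" "\<And>j. act (X j) w = 0" "\<phi> \<noteq> \<mu>"
  shows "w = 0"
proof (rule ccontr)
  assume "w \<noteq> 0"
  then have w: "hw_vector w \<phi>" using assms by (simp add: hw_vector_def)
  have "\<phi> \<in> weight_cone a \<mu>"
    using hw_weights[OF assms(1)] w by (auto simp: weights_def hw_vector_def)
  moreover have "\<mu> \<in> weight_cone a \<phi>"
    using hw_weights[OF w] assms(1) by (auto simp: weights_def hw_vector_def)
  ultimately show False using weight_cone_antisym assms(4) by blast
qed

text \<open>First some power of \<open>Y k\<close> kills the highest weight vector; then the vectors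
  killed by some power form a submodule, because bracketing with \<open>Y k\<close> is nilpotent on
  all generators.\<close>

lemma Y_nilpotent:
  assumes hw: "hw_vector u \<mu>" and "q k = 0" "a k (h k) = 2" and \<mu>: "\<mu> (h k) = of_nat m"
    and serre: "\<And>i. i \<noteq> k \<Longrightarrow> br (Y k) (br (Y k) (Y i)) = 0"
  shows "locally_nilpotent (act (Y k))"
proof -
  let ?y = "act (Y k)"
  have Yk: "Y k \<in> gr 0" using Y_gr[of k] assms(2) by simp
  have u: "u \<in> Wt \<mu>" "\<And>j. act (X j) u = 0" "u \<noteq> 0" using hw by (auto simp: hw_vector_def)
  \<comment> \<open>This vector is singular of a weight other than \<mu>: the coefficient in
    \<open>X_Y_pow\<close> vanishes at \<open>j = m\<close>, and the other \<open>X j\<close>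
    commute with \<open>Y k\<close>.\<close>
  have nil_u: "(?y ^^ Suc m) u = 0"
  proof (rule singular_eq_0[OF hw])
    show "(?y ^^ Suc m) u \<in> Wt (\<lambda>z. \<mu> z - of_nat (Suc m) * a k z)" by (rule Y_pow_weight[OF u(1)])
    show "(\<lambda>z. \<mu> z - of_nat (Suc m) * a k z) \<noteq> \<mu>"
    proof
      assume "(\<lambda>z. \<mu> z - of_nat (Suc m) * a k z) = \<mu>"
      from fun_cong[OF this, of "h k"] show False using assms(3) by (simp del: of_nat_Suc)
    qed
    show "act (X j) ((?y ^^ Suc m) u) = 0" for j
    proof (cases "j = k")
      case True
      then show ?thesis using X_Y_pow[OF assms(2,3) u(1,2), of m] \<mu> by simp
    next
      case False
      have "act (X j) ((?y ^^ N) u) = 0" for N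
        by (induction N) (use u False assms(2) in \<open>auto simp: act_act[OF X_gr Y_gr] X_Y act_simps\<close>)
      then show ?thesis .
    qed
  qed
  define W where "W = {w. \<exists>N. (?y ^^ N) w = 0}"
  have lin: "(?y ^^ N) (v + w) = (?y ^^ N) v + (?y ^^ N) w"
    "(?y ^^ N) (vscale c v) = vscale c ((?y ^^ N) v)" "(?y ^^ N) 0 = 0" for N c v w
    by (induction N) (auto simp: act_simps)
  have mono: "(?y ^^ (M + N)) w = 0" if "(?y ^^ N) w = 0" for M N w
    using that by (simp add: funpow_add lin)
  have sub: "V.subspace W"
  proof (rule V.subspaceI)
    show "0 \<in> W" by (auto simp: W_def intro: exI[of _ 0])
    show "v + w \<in> W" if "v \<in> W" "w \<in> W" for v w
    proof -
      obtain M N where "(?y ^^ M) v = 0" "(?y ^^ N) w = 0" using \<open>v \<in> W\<close> \<open>w \<in> W\<close> by (auto simp: W_def)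
      then have "(?y ^^ (M + N)) (v + w) = 0"
        using mono[of N w M] mono[of M v N] by (simp add: lin add.commute)
      then show ?thesis by (auto simp: W_def)
    qed
    show "vscale c w \<in> W" if "w \<in> W" for c w using that by (auto simp: W_def lin)
  qed
  \<comment> \<open>Each application of the even \<open>Y k\<close> falls on \<open>x\<close> or on
    \<open>w\<close>, so after \<open>M + N\<close> of them one of the two is exhausted.\<close>
  have leibniz: "(?y ^^ n) (act x w) = 0"
    if "M + N \<le> n" "(br (Y k) ^^ M) x = 0" "(?y ^^ N) w = 0" for n M N x w
    using that
  proof (induction n arbitrary: M N x w)
    case 0
    then show ?case by (simp add: act_simps)
  next
    case (Suc n)
    show ?case
    proof (cases "M = 0 \<or> N = 0")
      case True
      then show ?thesis using Suc.prems by (auto simp: act_simps lin)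
    next
      case False
      then obtain M' N' where MN: "M = Suc M'" "N = Suc N'" by (metis not0_implies_Suc)
      have "(?y ^^ n) (act (br (Y k) x) w) = 0"
        by (rule Suc.IH[of M' N]) (use Suc.prems MN in \<open>auto simp: funpow_swap1\<close>)
      moreover have "(?y ^^ n) (act x (?y w)) = 0"
        by (rule Suc.IH[of M N']) (use Suc.prems MN in \<open>auto simp: funpow_swap1\<close>)
      moreover have "(?y ^^ Suc n) (act x w) = (?y ^^ n) (?y (act x w))" by (simp add: funpow_swap1)
      ultimately show ?thesis by (simp add: act_even[OF Yk] lin)
    qed
  qed
  have YY: "br (Y k) (Y k) = 0" using antisym_even[OF Yk, of "Y k"] by (rule double_eq_0)
  have "act x w \<in> W" if "w \<in> W" for x w
  proof (rule stable_generated[OF generates sub _ that], intro conjI ballI)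
    fix s assume s: "s \<in> range H \<union> range X \<union> range Y"
    then show "\<exists>a. s \<in> gr a" using H_even X_gr Y_gr by blast
    \<comment> \<open>The exponent 3 is due to \<open>X k\<close>, which goes to a multiple of
      \<open>H (h k)\<close>, then of \<open>Y k\<close>, then to zero.\<close>
    have "(br (Y k) ^^ 3) s = 0"
      using s YY serre by (auto simp: numeral_3_eq_3 Y_H Y_X br_simps)
         (metis br_zero_right)
    then show "act s w \<in> W" if "w \<in> W" for w
      using leibniz[OF order_refl, of 3 s] that by (auto simp: W_def)
  qed
  moreover have "graded_subspace vscale vgr W"
    unfolding graded_subspace_def
  proof (intro conjI sub ballI)
    fix w assume "w \<in> W"
    obtain x y where xy: "x \<in> vgr 0" "y \<in> vgr 1" "w = x + y" by (rule V.gr_cases)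
    obtain N where N: "(?y ^^ N) w = 0" using \<open>w \<in> W\<close> by (auto simp: W_def)
    have gr: "(?y ^^ N) v \<in> vgr b" if "v \<in> vgr b" for v b
    proof (induction N)
      case (Suc N)
      then show ?case using act_graded[OF Yk Suc] by (simp only: add_0 funpow.simps o_apply)
    qed (use that in simp)
    have "(?y ^^ N) x + (?y ^^ N) y = 0" using N by (simp add: xy lin)
    then have "(?y ^^ N) x = 0" "(?y ^^ N) y = 0"
      using V.gr_sum_0[OF gr[OF xy(1)] gr[OF xy(2)]] by auto
    then show "\<exists>x\<in>W \<inter> vgr 0. \<exists>y\<in>W \<inter> vgr 1. w = x + y" using xy by (auto simp: W_def)
  qed
  ultimately have "submodule vscale vgr act W" by (simp add: submodule_def)
  moreover have "u \<in> W" unfolding W_def using nil_u by blast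
  ultimately have "W = UNIV" using irreducible u(3) by auto
  then show ?thesis by (auto simp: W_def locally_nilpotent_def)
qed

end

section \<open>Chevalley generators of a contragredient Lie superalgebra\<close>

lemma lookup_free_scale [simp]: "Poly_Mapping.lookup (free_scale c f) t = c * Poly_Mapping.lookup f t"
  by (simp add: free_scale_def Poly_Mapping.map.rep_eq when_def)

section \<open>Evaluation of free nonassociative elements\<close>

context lie_superalgebra
begin

lemma free_eval_superset:
  assumes "finite F" "Poly_Mapping.keys f \<subseteq> F"
  shows "free_eval sc br e f = (\<Sum>t\<in>F. sc (Poly_Mapping.lookup f t) (magma_eval br e t))"
  unfolding free_eval_def
  by (rule sum.mono_neutral_left) (use assms in \<open>auto simp: in_keys_iff\<close>)

lemma free_eval_add: "free_eval sc br e (f + g) = free_eval sc br e f + free_eval sc br e g"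
proof -
  let ?F = "Poly_Mapping.keys f \<union> Poly_Mapping.keys g"
  have "Poly_Mapping.keys (f + g) \<subseteq> ?F" by (rule Poly_Mapping.keys_add)
  then show ?thesis
    by (simp add: free_eval_superset[of ?F] lookup_add scale_left_distrib sum.distrib)
qed

lemma free_eval_scale: "free_eval sc br e (free_scale c f) = sc c (free_eval sc br e f)"
proof -
  have "Poly_Mapping.keys (free_scale c f) \<subseteq> Poly_Mapping.keys f" by (auto simp: in_keys_iff)
  then show ?thesis
    by (simp add: free_eval_superset[of "Poly_Mapping.keys f"] scale_sum_right)
qed

lemma free_eval_0: "free_eval sc br e 0 = 0"
  by (simp add: free_eval_def)

lemma free_eval_diff: "free_eval sc br e (f - g) = free_eval sc br e f - free_eval sc br e g"
  using free_eval_add[of e "f - g" g] by simp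

lemma free_eval_sum: "free_eval sc br e (\<Sum>i\<in>A. f i) = (\<Sum>i\<in>A. free_eval sc br e (f i))"
  by (induction A rule: infinite_finite_induct) (simp_all add: free_eval_0 free_eval_add)

lemma free_eval_single: "free_eval sc br e (Poly_Mapping.single t c) = sc c (magma_eval br e t)"
  by (simp add: free_eval_def)

lemma free_eval_gen: "free_eval sc br e (free_gen x) = e x"
  by (simp add: free_gen_def free_eval_single)

lemma free_eval_br: "free_eval sc br e (free_br f g) = br (free_eval sc br e f) (free_eval sc br e g)"
proof -
  have "br (free_eval sc br e f) (free_eval sc br e g) =
    (\<Sum>s\<in>Poly_Mapping.keys f. br (sc (Poly_Mapping.lookup f s) (magma_eval br e s)) (free_eval sc br e g))"
    unfolding free_eval_def[of _ _ _ f] by (rule lin_sum[OF br_linear_left])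
  also have "\<dots> = free_eval sc br e (free_br f g)"
    by (simp add: free_br_def free_eval_sum free_eval_single)
      (simp add: free_eval_def lin_sum[OF br_linear_right] br_simps mult.commute)
  finally show ?thesis by simp
qed

lemma magma_eval_gr:
  assumes "\<And>x. e x \<in> gr (par x)"
  shows "magma_eval br e t \<in> gr (magma_parity par t)"
proof (induction t)
  case (Br s t)
  from br_graded[OF Br] show ?case by (simp only: magma_eval.simps magma_parity.simps)
qed (simp add: assms)

lemma free_eval_gr:
  assumes "\<And>x. e x \<in> gr (par x)" "f \<in> free_gr par b"
  shows "free_eval sc br e f \<in> gr b"
  unfolding free_eval_def
  by (rule subspace_sum[OF gr_subspace])
    (use assms magma_eval_gr[of e par] in \<open>auto simp: free_gr_def intro!: gr_scale\<close>)

lemma free_split: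
  obtains f0 f1 where "f0 \<in> free_gr par 0" "f1 \<in> free_gr par 1" "f = f0 + f1"
proof
  define part where "part b = (\<Sum>t\<in>{t \<in> Poly_Mapping.keys f. magma_parity par t = b}.
    Poly_Mapping.single t (Poly_Mapping.lookup f t))" for b
  have lookup: "Poly_Mapping.lookup (part b) t = (if magma_parity par t = b then Poly_Mapping.lookup f t else 0)" for b t
  proof -
    have "Poly_Mapping.lookup (part b) t =
      (\<Sum>s\<in>{t \<in> Poly_Mapping.keys f. magma_parity par t = b}. if s = t then Poly_Mapping.lookup f t else 0)"
      unfolding part_def lookup_sum by (intro sum.cong refl) (auto simp: lookup_single when_def)
    then show ?thesis by (simp add: in_keys_iff)
  qed
  have "part b \<in> free_gr par b" for b by (auto simp: free_gr_def in_keys_iff lookup split: if_splits)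
  then show "part 0 \<in> free_gr par 0" "part 1 \<in> free_gr par 1" by blast+
  show "f = part 0 + part 1" by (rule poly_mapping_eqI) (simp add: lookup_add lookup)
qed

end

section \<open>From the presentation to Chevalley generators\<close>

context contragredient
begin

abbreviation "ev \<equiv> free_eval gscale br (chev_image H X Y)"

lemma ev_gr: "f \<in> free_gr (chev_parity p) b \<Longrightarrow> ev f \<in> gr b"
  by (rule g.free_eval_gr[OF gens_graded])

lemma ev_relation: "f \<in> chev_relations hscale hc rt p \<Longrightarrow> ev f = 0"
  using eval_kernel_mem by (auto simp: cartan_free_ideals_def chev_ideal_def)

lemmas ev_simps = g.free_eval_add g.free_eval_diff g.free_eval_scale g.free_eval_br g.free_eval_gen

lemma H_rel:
  "H (x + y) = H x + H y" "H (hscale c x) = gscale c (H x)" "br (H x) (H y) = 0"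
  "br (H x) (X i) = gscale (rt i x) (X i)" "br (H x) (Y i) = gscale (- rt i x) (Y i)"
  "br (X i) (Y j) = (if i = j then H (hc i) else 0)"
  using ev_relation[OF chev_relations.H_add, of x y] ev_relation[OF chev_relations.H_scale, of c x]
    ev_relation[OF chev_relations.H_H, of x y] ev_relation[OF chev_relations.H_X, of x i]
    ev_relation[OF chev_relations.H_Y, of x i] ev_relation[OF chev_relations.X_Y_same, of i]
    ev_relation[OF chev_relations.X_Y_diff, of i j]
  by (auto simp: ev_simps algebra_simps eq_neg_iff_add_eq_0)

text \<open>The preimage of \<open>J\<close> under evaluation belongs to
  \<open>cartan_free_ideals\<close>, so maximality puts it into the kernel; evaluation is
  surjective.\<close>

lemma ideal_eq_0:
  assumes J: "super_ideal gscale gr br J" and JH: "J \<inter> range H \<subseteq> {0}"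
  shows "J \<subseteq> {0}"
proof -
  interpret F: vector_space free_scale by (rule vector_space_free_scale)
  let ?J = "{f. ev f \<in> J}"
  have sub: "g.subspace J" and split: "\<And>u. u \<in> J \<Longrightarrow> \<exists>x\<in>J \<inter> gr 0. \<exists>y\<in>J \<inter> gr 1. u = x + y"
    and br: "\<And>x y. x \<in> J \<Longrightarrow> br x y \<in> J \<and> br y x \<in> J"
    using J by (auto simp: super_ideal_def graded_subspace_def)
  have "super_ideal free_scale (free_gr (chev_parity p)) free_br ?J"
    unfolding super_ideal_def graded_subspace_def
  proof (intro conjI ballI allI)
    show "F.subspace ?J"
      by (rule F.subspaceI)
        (use sub in \<open>auto simp: ev_simps g.free_eval_0 g.subspace_0 g.subspace_add g.subspace_scale\<close>)
    fix u assume u: "u \<in> ?J"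
    obtain f0 f1 where f: "f0 \<in> free_gr (chev_parity p) 0" "f1 \<in> free_gr (chev_parity p) 1" "u = f0 + f1"
      by (rule g.free_split)
    obtain x y where "x \<in> J" "x \<in> gr 0" "y \<in> J" "y \<in> gr 1" "ev u = x + y"
      using split[of "ev u"] u by auto
    \<comment> \<open>Evaluation respects parity, and homogeneous parts are unique.\<close>
    then have "ev f0 = x" "ev f1 = y"
      using g.gr_sum_eq[OF ev_gr[OF f(1)] ev_gr[OF f(2)], of x y] by (auto simp: f(3) ev_simps)
    then show "\<exists>x\<in>?J \<inter> free_gr (chev_parity p) 0. \<exists>y\<in>?J \<inter> free_gr (chev_parity p) 1. u = x + y"
      using f \<open>x \<in> J\<close> \<open>y \<in> J\<close> by auto
  qed (use br in \<open>auto simp: ev_simps\<close>)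
  moreover have "chev_ideal hscale hc rt p \<subseteq> ?J"
    using eval_kernel_mem g.subspace_0[OF sub] by (auto simp: cartan_free_ideals_def)
  moreover have "free_gen (GH x) \<in> chev_ideal hscale hc rt p" if "free_gen (GH x) \<in> ?J" for x
  proof -
    have "H x = 0" using that JH by (auto simp: ev_simps)
    then have "ev (free_gen (GH x)) = 0" by (simp add: ev_simps)
    then show ?thesis using eval_kernel_mem by (auto simp: cartan_free_ideals_def)
  qed
  ultimately have "?J \<in> cartan_free_ideals hscale hc rt p" by (simp add: cartan_free_ideals_def)
  then have J0: "ev f = 0" if "ev f \<in> J" for f using eval_kernel_greatest that by blast
  show ?thesis
  proof
    fix x assume "x \<in> J"
    moreover obtain f where "x = ev f" using eval_surj by (metis rangeE UNIV_I)
    ultimately show "x \<in> {0}" using J0 by simp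
  qed
qed

lemma cartan: "cartan hscale gscale gr br H"
proof (intro cartan.intro cartan_axioms.intro g.lie_superalgebra_axioms vector_space_axioms)
  show "Vector_Spaces.linear hscale gscale H"
    by (auto simp: Vector_Spaces.linear_iff H_rel vector_space_axioms g.vector_space_axioms)
  show "H x \<in> gr 0" for x using gens_graded[of "GH x"] by simp
  show "br (H x) (H y) = 0" for x y by (rule H_rel)
qed (rule ideal_eq_0)

lemma generators: "generated_subalgebra gscale br (range H \<union> range X \<union> range Y) = UNIV"
proof -
  let ?G = "generated_subalgebra gscale br (range H \<union> range X \<union> range Y)"
  have "chev_image H X Y x \<in> ?G" for x by (cases x) (auto intro: g.generated_base)
  then have "magma_eval br (chev_image H X Y) t \<in> ?G" for t
    by (induction t) (auto intro: g.generated_br)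
  then have "ev f \<in> ?G" for f
    unfolding free_eval_def by (intro g.subspace_sum[OF g.subspace_generated] g.generated_scale)
  then show ?thesis using eval_surj by (metis UNIV_eq_I rangeE UNIV_I)
qed

lemma chev_system: "chev_system hscale gscale gr br H p hc rt X Y"
proof (intro chev_system.intro chev_system_axioms.intro cartan rt_linear generators)
  show "X i \<in> gr (p i)" "Y i \<in> gr (p i)" for i
    using gens_graded[of "GX i"] gens_graded[of "GY i"] by simp_all
qed (auto simp: root_space_def H_rel intro: rt_independent)

end

section \<open>Bases of \<open>S(1,2,\<alpha>)\<close>\<close>

context chev_system
begin

lemma serre_even_Y:
  assumes "q k = 0" "a i (h k) = - a k (h k) / 2" "i \<noteq> k"
  shows "br (Y k) (br (Y k) (Y i)) = 0"
  by (rule chev_system.serre_even[OF flip])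
    (use assms in \<open>simp_all add: lin_minus[OF a_linear]\<close>)

lemma serre_odd2_Y:
  assumes "q k = 1" "a k (h k) = 0"
  shows "br (Y k) (br (Y k) y) = 0"
  by (rule chev_system.serre_odd2[OF flip])
    (use assms in \<open>simp_all add: lin_scale[OF a_linear]\<close>)

lemma refl_entry:
  "refl_root a k j (refl_coroot hscale a h k i) = (if i = k then refl_root a k j (h k)
     else a i (h k) * refl_root a k j (h i) + a k (h i) * refl_root a k j (h k))"
  by (simp add: refl_root_def refl_coroot_def lin_add[OF a_linear] lin_scale[OF a_linear] algebra_simps)

lemma base_datum: "base_datum gscale gr br H q h a"
  unfolding base_datum_def
  by (rule exI[of _ X], rule exI[of _ Y]) (simp add: X_root Y_root X_gr Y_gr X_Y generates)

lemma from_base_datum: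
  assumes "base_datum gscale gr br H q' h' a"
  obtains X' Y' where "chev_system hscale gscale gr br H q' h' a X' Y'"
proof -
  from assms obtain X' Y' where *: "\<And>i. X' i \<in> root_space gscale br H (a i) \<inter> gr (q' i)"
    "\<And>i. Y' i \<in> root_space gscale br H (\<lambda>x. - a i x) \<inter> gr (q' i)"
    "\<And>i j. br (X' i) (Y' j) = (if i = j then H (h' i) else 0)"
    "generated_subalgebra gscale br (range H \<union> range X' \<union> range Y') = UNIV"
    unfolding base_datum_def by blast
  have "chev_system hscale gscale gr br H q' h' a X' Y'"
    by (intro chev_system.intro chev_system_axioms.intro cartan_axioms)
      (use * in \<open>auto intro: a_linear a_independent\<close>)
  then show ?thesis by (rule that)
qed

end

text \<open>
  Up to a permutation of the indices and nonzero multiples of the rows, the Cartan matrix is that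
  of \<open>S(1,2,\<beta>)\<close>: \<open>e\<close> is the even index, \<open>u\<close> and \<open>v\<close> are the odd ones.
\<close>

definition S12_type :: "('n \<Rightarrow> bit) \<Rightarrow> ('n \<Rightarrow> 'h) \<Rightarrow> ('n \<Rightarrow> 'h \<Rightarrow> complex) \<Rightarrow> 'n \<Rightarrow> 'n \<Rightarrow> 'n \<Rightarrow> complex \<Rightarrow> bool" where
  "S12_type q h a e u v \<beta> \<longleftrightarrow>
     e \<noteq> u \<and> e \<noteq> v \<and> u \<noteq> v \<and> UNIV = {e, u, v} \<and> q e = 0 \<and> q u = 1 \<and> q v = 1 \<and> \<beta> \<noteq> 0 \<and> 1 / \<beta> \<notin> \<int> \<and>
     a e (h e) \<noteq> 0 \<and> a u (h e) = - a e (h e) / 2 \<and> a v (h e) = - a e (h e) / 2 \<and>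
     a u (h u) = 0 \<and> a v (h u) \<noteq> 0 \<and> a e (h u) = (\<beta> - 1) * a v (h u) \<and>
     a v (h v) = 0 \<and> a u (h v) \<noteq> 0 \<and> a e (h v) = (- 1 - \<beta>) * a u (h v)"

text \<open>Thanks to this symmetry odd reflections are computed at \<open>u\<close> only.\<close>

lemma S12_type_swap: "S12_type q h a e u v \<beta> \<Longrightarrow> S12_type q h a e v u (- \<beta>)"
  unfolding S12_type_def using Ints_minus[of "1 / - \<beta>"] by auto

text \<open>The values 1 and -1 have integral inverses; excluding them keeps all off-diagonal
  entries nonzero.\<close>

lemma S12_type_param:
  assumes "S12_type q h a e u v \<beta>"
  shows "\<beta> - 1 \<noteq> 0" "- 1 - \<beta> \<noteq> 0"
proof -
  have "1 / \<beta> \<notin> \<int>" using assms by (simp add: S12_type_def)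
  then show "\<beta> - 1 \<noteq> 0" "- 1 - \<beta> \<noteq> 0" by (auto simp: eq_neg_iff_add_eq_0[symmetric] right_minus_eq minus_equation_iff)
qed

lemma S12_type_nonzero:
  assumes "S12_type q h a e u v \<beta>" "i \<noteq> k"
  shows "a i (h k) \<noteq> 0"
proof -
  have "i \<in> {e, u, v}" "k \<in> {e, u, v}" using assms(1) unfolding S12_type_def by blast+
  then show ?thesis using assms S12_type_param[OF assms(1)] by (auto simp: S12_type_def)
qed

lemma S12_type_even_row:
  assumes "S12_type q h a e u v \<beta>" "i \<noteq> e"
  shows "a i (h e) = - a e (h e) / 2"
proof -
  have "i \<in> {e, u, v}" using assms(1) unfolding S12_type_def by blast
  then show ?thesis using assms by (auto simp: S12_type_def)
qed

definition S12_system where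
  "S12_system hscale gscale gr br H q h a X Y e u v \<beta> \<longleftrightarrow>
     chev_system hscale gscale gr br H q h a X Y \<and> S12_type q h a e u v \<beta> \<and>
     (\<forall>i. X i \<noteq> 0 \<and> Y i \<noteq> 0)"

lemma S12_system_swap:
  "S12_system hscale gscale gr br H q h a X Y e u v \<beta> \<Longrightarrow>
   S12_system hscale gscale gr br H q h a X Y e v u (- \<beta>)"
  by (auto simp: S12_system_def intro: S12_type_swap)

text \<open>The Cartan integers at \<open>e\<close> are -1, so the Serre relations make
  \<open>reflect\<close> applicable; the new entries are computed from
  \<open>refl_entry\<close>.\<close>

lemma S12_system_even_reflection:
  assumes "S12_system hscale gscale gr br H q h a X Y e u v \<beta>"
  shows "S12_system hscale gscale gr br H (refl_par q e) (refl_coroot hscale a h e) (refl_root a e)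
      (chev_system.refl_X br X Y e) (chev_system.refl_Y gscale br q X Y e) e u v \<beta>"
    and "even_reflection h a e = refl_root a e"
proof -
  interpret chev_system hscale gscale gr br H q h a X Y using assms by (simp add: S12_system_def)
  have S: "S12_type q h a e u v \<beta>" and nz: "\<And>i. X i \<noteq> 0" "\<And>i. Y i \<noteq> 0"
    using assms by (auto simp: S12_system_def)
  have ai: "a i (h e) = - a e (h e) / 2" if "i \<noteq> e" for i by (rule S12_type_even_row[OF S that])
  have qe: "q e = 0" using S by (simp add: S12_type_def)
  have R: "chev_system hscale gscale gr br H (refl_par q e) (refl_coroot hscale a h e) (refl_root a e)
      (refl_X e) (refl_Y e)"
    by (rule reflect) (rule S12_type_nonzero[OF S] serre_even[OF qe ai] serre_even_Y[OF qe ai]; assumption)+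
  have eqs: "e \<noteq> u" "e \<noteq> v" "u \<noteq> v" "UNIV = {e, u, v}" "q e = 0" "q u = 1" "q v = 1"
    "\<beta> \<noteq> 0" "1 / \<beta> \<notin> \<int>" "a e (h e) \<noteq> 0" "a u (h e) = - a e (h e) / 2" "a v (h e) = - a e (h e) / 2"
    "a u (h u) = 0" "a v (h u) \<noteq> 0" "a e (h u) = (\<beta> - 1) * a v (h u)"
    "a v (h v) = 0" "a u (h v) \<noteq> 0" "a e (h v) = (- 1 - \<beta>) * a u (h v)"
    using S unfolding S12_type_def by blast+
  have T: "S12_type (refl_par q e) (refl_coroot hscale a h e) (refl_root a e) e u v \<beta>"
    unfolding S12_type_def
    by (intro conjI eqs(4); (unfold refl_entry)?; simp add: refl_par_def refl_root_def eqs(1-3)[THEN not_sym] eqs(1-3) eqs(5-) field_simps)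
  show "S12_system hscale gscale gr br H (refl_par q e) (refl_coroot hscale a h e) (refl_root a e)
      (refl_X e) (refl_Y e) e u v \<beta>"
    unfolding S12_system_def using R T refl_nonzero[OF S12_type_nonzero[OF S] nz] by blast
  have "a e (h e) \<noteq> 0" using S by (simp add: S12_type_def)
  then show "even_reflection h a e = refl_root a e"
    using ai by (auto simp: even_reflection_def refl_root_def fun_eq_iff)
qed

text \<open>The new even root is \<open>a v + a u\<close>, while \<open>a e + a u\<close> is odd, so
  \<open>v\<close> and \<open>e\<close> exchange roles. The new parameter has inverse
  \<open>1 - 1 / \<beta>\<close>, again not an integer.\<close>

lemma S12_system_odd_reflection:
  assumes "S12_system hscale gscale gr br H q h a X Y e u v \<beta>"
  shows "S12_system hscale gscale gr br H (refl_par q u) (refl_coroot hscale a h u) (refl_root a u)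
      (chev_system.refl_X br X Y u) (chev_system.refl_Y gscale br q X Y u) v u e (\<beta> / (\<beta> - 1))"
    and "odd_reflection h a u = refl_root a u"
proof -
  interpret chev_system hscale gscale gr br H q h a X Y using assms by (simp add: S12_system_def)
  have S: "S12_type q h a e u v \<beta>" and nz: "\<And>i. X i \<noteq> 0" "\<And>i. Y i \<noteq> 0"
    using assms by (auto simp: S12_system_def)
  have qu: "q u = 1" "a u (h u) = 0" using S by (auto simp: S12_type_def)
  have R: "chev_system hscale gscale gr br H (refl_par q u) (refl_coroot hscale a h u) (refl_root a u)
      (refl_X u) (refl_Y u)"
    by (rule reflect) (rule S12_type_nonzero[OF S] serre_odd2[OF qu] serre_odd2_Y[OF qu]; assumption)+
  have b: "\<beta> - 1 \<noteq> 0" "\<beta> \<noteq> 1" "\<beta> \<noteq> 0" using S12_type_param[OF S] S by (auto simp: S12_type_def)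
  have "1 / (\<beta> / (\<beta> - 1)) = 1 - 1 / \<beta>" using b by (simp add: field_simps)
  then have Z: "1 / (\<beta> / (\<beta> - 1)) \<notin> \<int>"
    using Ints_diff[OF Ints_1, of "1 - 1 / \<beta>"] S by (auto simp: S12_type_def)
  have eqs: "e \<noteq> u" "e \<noteq> v" "u \<noteq> v" "UNIV = {e, u, v}" "q e = 0" "q u = 1" "q v = 1"
    "\<beta> \<noteq> 0" "1 / \<beta> \<notin> \<int>" "a e (h e) \<noteq> 0" "a u (h e) = - a e (h e) / 2" "a v (h e) = - a e (h e) / 2"
    "a u (h u) = 0" "a v (h u) \<noteq> 0" "a e (h u) = (\<beta> - 1) * a v (h u)"
    "a v (h v) = 0" "a u (h v) \<noteq> 0" "a e (h v) = (- 1 - \<beta>) * a u (h v)"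
    using S unfolding S12_type_def by blast+
  have univ: "UNIV = {v, u, e}" using eqs(4) by blast
  have T: "S12_type (refl_par q u) (refl_coroot hscale a h u) (refl_root a u) v u e (\<beta> / (\<beta> - 1))"
    unfolding S12_type_def
    by (intro conjI Z univ; (unfold refl_entry)?; simp add: b refl_par_def refl_root_def eqs(1-3)[THEN not_sym] eqs(1-3) eqs(5-) field_simps)
  show "S12_system hscale gscale gr br H (refl_par q u) (refl_coroot hscale a h u) (refl_root a u)
      (refl_X u) (refl_Y u) v u e (\<beta> / (\<beta> - 1))"
    unfolding S12_system_def using R T refl_nonzero[OF S12_type_nonzero[OF S] nz] by blast
  show "odd_reflection h a u = refl_root a u"
    using S12_type_nonzero[OF S] by (auto simp: odd_reflection_def refl_root_def fun_eq_iff)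
qed

text \<open>\<open>base_datum\<close> leaves the generators open. Another choice only rescales rows,
  by \<open>chev_system_unique\<close>, and \<open>S12_type\<close> is invariant under that.\<close>

lemma S12_system_base_datum:
  assumes S: "S12_system hscale gscale gr br H q h a X Y e u v \<beta>"
    and B: "base_datum gscale gr br H q' h' a"
  shows "\<exists>X' Y'. S12_system hscale gscale gr br H q' h' a X' Y' e u v \<beta>"
proof -
  have C: "chev_system hscale gscale gr br H q h a X Y" and nz: "\<And>i. X i \<noteq> 0" "\<And>i. Y i \<noteq> 0"
    and T: "S12_type q h a e u v \<beta>"
    using S by (auto simp: S12_system_def)
  obtain X' Y' where C': "chev_system hscale gscale gr br H q' h' a X' Y'"
    by (rule chev_system.from_base_datum[OF C B])
  note U = chev_system_unique[OF C C' nz]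
  obtain c where c: "\<And>i. c i \<noteq> 0" "\<And>i j. a j (h' i) = c i * a j (h i)" using U(4) by metis
  have "S12_type q' h' a e u v \<beta>"
    using T c(1) unfolding S12_type_def by (simp add: U(3) c(2))
  then show ?thesis using C' U(1,2) unfolding S12_system_def by blast
qed

lemma refl_root_int:
  fixes a rt :: "'n::finite \<Rightarrow> 'h \<Rightarrow> complex"
  assumes "\<And>i. \<exists>c. \<forall>x. a i x = (\<Sum>j\<in>UNIV. of_int (c j) * rt j x)"
  shows "\<exists>c. \<forall>x. refl_root a k i x = (\<Sum>j\<in>UNIV. of_int (c j) * rt j x)"
proof -
  obtain c d where c: "\<And>x. a i x = (\<Sum>j\<in>UNIV. of_int (c j) * rt j x)"
    and d: "\<And>x. a k x = (\<Sum>j\<in>UNIV. of_int (d j) * rt j x)" using assms by metis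
  let ?c = "\<lambda>j. if i = k then - d j else c j + d j"
  have "refl_root a k i x = (\<Sum>j\<in>UNIV. of_int (?c j) * rt j x)" for x
    by (simp add: refl_root_def c d sum_negf ring_distribs sum.distrib)
  then show ?thesis by (intro exI[of _ ?c] allI)
qed

text \<open>The invariant of the induction: on \<open>hc e0\<close> the simple roots take the values
  2, -1, -1 up to a common sign \<open>s\<close>, which changes at each reflection; in particular
  none of them vanishes there.\<close>

lemma reflected_base_S12:
  assumes "reflected_base gscale gr br H p hc rt q h a"
    and init: "S12_system hscale gscale gr br H p hc rt X0 Y0 e0 u0 v0 \<beta>0"
    and rt: "rt e0 (hc e0) = 2"
  shows "\<exists>X Y e u v \<beta> s. S12_system hscale gscale gr br H q h a X Y e u v \<beta> \<and>
    (s = 1 \<or> s = - 1) \<and> a e (hc e0) = 2 * s \<and> a u (hc e0) = - s \<and> a v (hc e0) = - s \<and>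
    (\<forall>i. \<exists>c. \<forall>x. a i x = (\<Sum>j\<in>UNIV. of_int (c j) * rt j x))"
  using assms(1)
proof (induction rule: reflected_base.induct)
  case initial
  interpret chev_system hscale gscale gr br H p hc rt X0 Y0 using init by (simp add: S12_system_def)
  have "rt i x = (\<Sum>j\<in>UNIV. of_int (if j = i then 1 else 0) * rt j x)" for i x
    using a_eq_sum[of i x] by (simp add: if_distrib[of of_int] cong: if_cong)
  then have "\<forall>i. \<exists>c. \<forall>x. rt i x = (\<Sum>j\<in>UNIV. of_int (c j) * rt j x)" by (intro allI exI) assumption
  moreover have "S12_type p hc rt e0 u0 v0 \<beta>0" using init by (simp add: S12_system_def)
  ultimately show ?case
    using init rt by (intro exI[of _ X0] exI[of _ Y0] exI[of _ e0] exI[of _ u0] exI[of _ v0] exI[of _ \<beta>0] exI[of _ 1])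
      (simp add: S12_type_def)
next
  case (even q h a k q' h')
  then obtain X Y e u v \<beta> s where S: "S12_system hscale gscale gr br H q h a X Y e u v \<beta>"
    and s: "s = 1 \<or> s = - 1" "a e (hc e0) = 2 * s" "a u (hc e0) = - s" "a v (hc e0) = - s"
    and c: "\<And>i. \<exists>c. \<forall>x. a i x = (\<Sum>j\<in>UNIV. of_int (c j) * rt j x)" by blast
  have T: "S12_type q h a e u v \<beta>" using S by (simp add: S12_system_def)
  then have "k \<in> {e, u, v}" unfolding S12_type_def by blast
  then have k: "k = e" using T even.hyps(2) by (auto simp: S12_type_def)
  note R = S12_system_even_reflection[OF S]
  obtain X' Y' where S': "S12_system hscale gscale gr br H q' h' (refl_root a e) X' Y' e u v \<beta>"
    using S12_system_base_datum[OF R(1) even.hyps(3)[unfolded k R(2)]] by blast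
  have ci: "\<forall>i. \<exists>c. \<forall>x. refl_root a e i x = (\<Sum>j\<in>UNIV. of_int (c j) * rt j x)"
    by (intro allI refl_root_int[OF c])
  have s': "- s = 1 \<or> - s = - 1" using s(1) by auto
  have v: "refl_root a e e (hc e0) = 2 * - s" "refl_root a e u (hc e0) = - (- s)"
    "refl_root a e v (hc e0) = - (- s)"
    using s T by (auto simp: refl_root_def S12_type_def)
  show ?case unfolding k R(2) by (intro exI conjI) (fact S' s' v ci)+
next
  case (odd q h a k q' h')
  then obtain X Y e u v \<beta> s where S: "S12_system hscale gscale gr br H q h a X Y e u v \<beta>"
    and s: "s = 1 \<or> s = - 1" "a e (hc e0) = 2 * s" "a u (hc e0) = - s" "a v (hc e0) = - s"
    and c: "\<And>i. \<exists>c. \<forall>x. a i x = (\<Sum>j\<in>UNIV. of_int (c j) * rt j x)" by blast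
  have T: "S12_type q h a e u v \<beta>" using S by (simp add: S12_system_def)
  then have "k \<in> {e, u, v}" unfolding S12_type_def by blast
  then have "k = u \<or> k = v" using T odd.hyps(2,3) by (auto simp: S12_type_def)
  \<comment> \<open>By \<open>S12_system_swap\<close>, the index of the reflection may stand first
    among the odd ones.\<close>
  then obtain w \<gamma> where S: "S12_system hscale gscale gr br H q h a X Y e k w \<gamma>"
    and s: "s = 1 \<or> s = - 1" "a e (hc e0) = 2 * s" "a k (hc e0) = - s" "a w (hc e0) = - s"
    using S S12_system_swap[OF S] s by blast
  have T: "S12_type q h a e k w \<gamma>" using S by (simp add: S12_system_def)
  note R = S12_system_odd_reflection[OF S]
  obtain X' Y' where S': "S12_system hscale gscale gr br H q' h' (refl_root a k) X' Y' w k e (\<gamma> / (\<gamma> - 1))"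
    using S12_system_base_datum[OF R(1) odd.hyps(4)[unfolded R(2)]] by blast
  have ci: "\<forall>i. \<exists>c. \<forall>x. refl_root a k i x = (\<Sum>j\<in>UNIV. of_int (c j) * rt j x)"
    by (intro allI refl_root_int[OF c])
  have s': "- s = 1 \<or> - s = - 1" using s(1) by auto
  have v: "refl_root a k w (hc e0) = 2 * - s" "refl_root a k k (hc e0) = - (- s)"
    "refl_root a k e (hc e0) = - (- s)"
    using s T by (auto simp: refl_root_def S12_type_def)
  show ?case unfolding R(2) by (intro exI conjI) (fact S' s' v ci)+
qed

section \<open>Integrability\<close>

context chev_system
begin

text \<open>The algebra is then the abelian image of \<open>H\<close>, where \<open>H x\<close>
  cannot act on a nonzero vector by \<open>\<beta> x \<noteq> 0\<close>.\<close>

lemma no_roots: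
  assumes "\<And>i. X i = 0" "\<And>i. Y i = 0"
  shows "\<not> is_root gscale br H \<beta>"
proof
  assume root: "is_root gscale br H \<beta>"
  have "subspace (range H)"
    by (rule subspaceI)
      (auto simp: lin_zero[OF H_linear, symmetric] lin_add[OF H_linear, symmetric] lin_scale[OF H_linear, symmetric])
  moreover have "x \<in> range H \<Longrightarrow> y \<in> range H \<Longrightarrow> br x y \<in> range H" for x y
    using lin_zero[OF H_linear] H_H by (metis rangeE rangeI)
  moreover have "range H \<union> range X \<union> range Y \<subseteq> range H"
    using assms lin_zero[OF H_linear] by (metis (no_types, lifting) Un_least image_subset_iff rangeI)
  ultimately have "generated_subalgebra gscale br (range H \<union> range X \<union> range Y) \<subseteq> range H"
    unfolding generated_subalgebra_def by (intro Inter_lower) auto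
  then have range: "range H = UNIV" using generates by auto
  obtain x where x: "\<beta> x \<noteq> 0" using root by (auto simp: is_root_def)
  have "y = 0" if "y \<in> root_space gscale br H \<beta>" for y
  proof -
    obtain z where "y = H z" using range by blast
    then have "gscale (\<beta> x) y = 0" using that H_H[of x z] by (auto simp: root_space_def)
    then show ?thesis using x by simp
  qed
  moreover have "0 \<in> root_space gscale br H \<beta>" by (simp add: root_space_def br_simps)
  ultimately have "root_space gscale br H \<beta> = {0}" by blast
  then show False using root by (simp add: is_root_def)
qed

text \<open>
  Injectivity of \<open>H\<close> is not part of the definition of the algebra, so vanishing generators have to
  be considered.
\<close>

lemma generators_zero:
  assumes "S12_type q h a e u v \<beta>" "X k = 0 \<or> Y k = 0"
  shows "X i = 0" "Y i = 0" "H (h i) = 0"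
proof -
  have zero: "X j = 0 \<and> Y j = 0" if "X m = 0 \<or> Y m = 0" "j \<noteq> m" for j m
  proof -
    have "H (h m) = 0" using X_Y[of m m] that(1) by (auto simp: br_simps)
    then show ?thesis
      using H_X[of "h m" j] H_Y[of "h m" j] S12_type_nonzero[OF assms(1) that(2)] by (auto simp: br_simps)
  qed
  obtain m where m: "m \<noteq> k" using assms(1) unfolding S12_type_def by metis
  have "X i = 0 \<and> Y i = 0"
    using zero[of k i] zero[of k m] zero[of m k] assms(2) m by blast
  then show "X i = 0" "Y i = 0" "H (h i) = 0" using X_Y[of i i] by (auto simp: br_simps)
qed

text \<open>Even reflection at \<open>e\<close> makes \<open>- a e\<close> simple; in this way
  integrability bears on \<open>Y e\<close>.\<close>

lemma real_root_minus:
  assumes S: "S12_system hscale gscale gr br H q h a X Y e u v \<beta>"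
    and R: "reflected_base gscale gr br H p hc rt q h a"
  shows "real_root gscale gr br H p hc rt (\<lambda>x. - a e x)"
proof -
  interpret R: chev_system hscale gscale gr br H "refl_par q e" "refl_coroot hscale a h e" "refl_root a e"
    "refl_X e" "refl_Y e"
    using S12_system_even_reflection(1)[OF S] by (simp add: S12_system_def)
  have e0: "a e (h e) \<noteq> 0" and nz: "Y e \<noteq> 0" using S by (auto simp: S12_system_def S12_type_def)
  have "reflected_base gscale gr br H p hc rt (refl_par q e) (refl_coroot hscale a h e) (even_reflection h a e)"
    by (rule reflected_base.even[OF R e0]) (use R.base_datum S12_system_even_reflection(2)[OF S] in simp)
  moreover have "(\<lambda>x. - a e x) = refl_root a e e" by (simp add: refl_root_def fun_eq_iff)
  moreover have "is_root gscale br H (\<lambda>x. - a e x)"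
    using Y_root[of e] nz e0 by (auto simp: is_root_def)
  ultimately show ?thesis
    unfolding real_root_def S12_system_even_reflection(2)[OF S] by metis
qed

end

lemma real_root_S12:
  assumes "real_root gscale gr br H p hc rt \<gamma>"
    and "S12_system hscale gscale gr br H p hc rt X0 Y0 e u v \<beta>" "rt e (hc e) = 2"
  obtains c :: "_ \<Rightarrow> int" where "\<And>x. \<gamma> x = (\<Sum>j\<in>UNIV. of_int (c j) * rt j x)" "\<gamma> (hc e) \<noteq> 0"
proof -
  obtain q h a i where R: "reflected_base gscale gr br H p hc rt q h a" "\<gamma> = a i \<or> (\<lambda>x. \<gamma> x / 2) = a i"
    using assms(1) by (auto simp: real_root_def)
  obtain X Y e' u' v' \<beta>' s where S: "S12_system hscale gscale gr br H q h a X Y e' u' v' \<beta>'"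
    and s: "s = 1 \<or> s = - 1" "a e' (hc e) = 2 * s" "a u' (hc e) = - s" "a v' (hc e) = - s"
    and c: "\<forall>i. \<exists>c. \<forall>x. a i x = (\<Sum>j\<in>UNIV. of_int (c j) * rt j x)"
    using reflected_base_S12[OF R(1) assms(2,3)] by blast
  have "i \<in> {e', u', v'}" using S unfolding S12_system_def S12_type_def by blast
  then have nz: "a i (hc e) \<noteq> 0" using s by auto
  obtain c where c: "\<And>x. a i x = (\<Sum>j\<in>UNIV. of_int (c j) * rt j x)" using c by blast
  show ?thesis
  proof (rule disjE[OF R(2)])
    assume "\<gamma> = a i"
    then show ?thesis using that[of c] c nz by simp
  next
    assume "(\<lambda>x. \<gamma> x / 2) = a i"
    then have \<gamma>: "\<gamma> x = 2 * a i x" for x by (metis nonzero_mult_div_cancel_left times_divide_eq_right zero_neq_numeral)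
    have "\<gamma> x = (\<Sum>j\<in>UNIV. of_int (2 * c j) * rt j x)" for x
      unfolding \<gamma> c by (simp add: sum_distrib_left mult.assoc)
    moreover have "\<gamma> (hc e) \<noteq> 0" using nz by (simp add: \<gamma>)
    ultimately show ?thesis by (rule that)
  qed
qed

text \<open>The product of the two reflections translates by multiples of \<open>b0 + b1\<close>.\<close>

lemma translate_weights:
  fixes P :: "('h \<Rightarrow> complex) set"
  assumes P0: "\<And>\<phi>. \<phi> \<in> P \<Longrightarrow> (\<lambda>z. \<phi> z - \<phi> c0 * b0 z) \<in> P"
    and P1: "\<And>\<phi>. \<phi> \<in> P \<Longrightarrow> (\<lambda>z. \<phi> z - \<phi> c1 * b1 z) \<in> P"
    and b: "b0 c0 = 2" "b1 c1 = 2" "b0 c1 = - 2" "b1 c0 = - 2"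
    and \<beta>: "\<beta> c1 = - \<beta> c0"
    and \<phi>: "\<And>N. (\<lambda>z. \<phi> z + of_nat N * \<beta> z) \<in> P"
  shows "\<exists>\<psi>. \<forall>N. (\<lambda>z. \<psi> z + of_nat N * (\<beta> z + of_nat m * \<beta> c1 * (b0 z + b1 z))) \<in> P"
proof (induction m)
  case 0
  then show ?case using \<phi> by auto
next
  case (Suc m)
  then obtain \<psi> where \<psi>: "\<And>N. (\<lambda>z. \<psi> z + of_nat N * (\<beta> z + of_nat m * \<beta> c1 * (b0 z + b1 z))) \<in> P" by blast
  \<comment> \<open>Reflect with \<open>b0\<close>, then with \<open>b1\<close>. As
    \<open>b0 + b1\<close> vanishes on \<open>c0\<close> and \<open>c1\<close>, the direction gains
    one more \<open>\<beta> c1 * (b0 z + b1 z)\<close>.\<close>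
  define \<psi>0 where "\<psi>0 z = \<psi> z - \<psi> c0 * b0 z" for z
  define \<psi>1 where "\<psi>1 z = \<psi>0 z - \<psi>0 c1 * b1 z" for z
  have "(\<lambda>z. \<psi>1 z + of_nat N * (\<beta> z + of_nat (Suc m) * \<beta> c1 * (b0 z + b1 z))) \<in> P" for N
  proof -
    have 0: "(\<lambda>z. \<psi>0 z + of_nat N * (\<beta> z - \<beta> c0 * b0 z + of_nat m * \<beta> c1 * (b0 z + b1 z))) \<in> P"
      using P0[OF \<psi>[of N]] by (simp add: \<psi>0_def b algebra_simps)
    show ?thesis
      using P1[OF 0] by (simp add: \<psi>1_def b \<beta> algebra_simps)
  qed
  then show ?case by blast
qed

section \<open>Odd reflection of highest weights and the integrability criterion\<close>

context irreducible_chev_module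
begin

text \<open>If \<open>\<mu> (h k) \<noteq> 0\<close>, \<open>act (Y k) w\<close> is nonzero and
  killed by \<open>Y k\<close>, and serves as \<open>w'\<close>. Otherwise it is singular of a
  different weight, hence zero, and \<open>w\<close> itself serves.\<close>

lemma hw_odd_reflection:
  assumes hw: "hw_vector w \<mu>" and k: "q k = 1" "a k (h k) = 0" "j \<noteq> k" "a k (h j) \<noteq> 0"
  shows "\<exists>w'. w' \<noteq> 0 \<and> w' \<in> Wt (if \<mu> (h k) = 0 then \<mu> else (\<lambda>z. \<mu> z - a k z)) \<and>
    (\<forall>i. act (refl_X k i) w' = 0)"
proof -
  have w: "w \<noteq> 0" "w \<in> Wt \<mu>" "\<And>i. act (X i) w = 0" using hw by (auto simp: hw_vector_def)
  have Yw: "act (Y k) w \<in> Wt (\<lambda>z. \<mu> z - a k z)" using Y_pow_weight[OF w(2), of 1 k] by simp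
  have XY: "act (X i) (act (Y k) w) = (if i = k then vscale (\<mu> (h k)) w else 0)" for i
    using act_act[OF X_gr Y_gr, of i k w] w by (simp add: X_Y weight_space_def act_simps)
  show ?thesis
  proof (cases "\<mu> (h k) = 0")
    case True
    \<comment> \<open>As \<open>a k\<close> vanishes on \<open>h k\<close>, the two weights are told
      apart on \<open>h j\<close>.\<close>
    have ne: "(\<lambda>z. \<mu> z - a k z) \<noteq> \<mu>"
    proof
      assume "(\<lambda>z. \<mu> z - a k z) = \<mu>"
      from fun_cong[OF this, of "h j"] show False using k(4) by simp
    qed
    have "act (Y k) w = 0"
      by (rule singular_eq_0[OF hw Yw _ ne]) (simp add: XY True)
    then show ?thesis
      using w True by (intro exI[of _ w]) (simp add: refl_X_def act_br[OF X_gr X_gr] act_simps)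
  next
    case False
    have "act (Y k) w \<noteq> 0" using XY[of k] False w(1) by (auto simp: act_simps)
    moreover have "act (Y k) (act (Y k) w) = 0"
    proof -
      have "vscale 2 (act (Y k) (act (Y k) w)) = act (br (Y k) (Y k)) w"
        using act_br[OF Y_gr Y_gr, of k k w] V.scale_left_distrib[of 1 1 "act (Y k) (act (Y k) w)"] k(1) by simp
      moreover have "br (Y k) (Y k) = 0"
        by (rule chev_system.serre_odd[OF flip]) (use k in \<open>simp_all add: lin_scale[OF a_linear]\<close>)
      ultimately show ?thesis by (simp add: act_simps)
    qed
    ultimately show ?thesis
      using Yw False w(3) by (intro exI[of _ "act (Y k) w"]) (simp add: refl_X_def act_br[OF X_gr X_gr] XY act_simps)
  qed
qed

end

text \<open>Rows are scaled so that \<open>h u + h v\<close> is the coroot, of value 2, of the even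
  root \<open>a u + a v\<close>, which is simple after reflection at \<open>u\<close>.\<close>

locale S12_module = irreducible_chev_module hscale gscale gr br H q h a X Y vscale vgr act
  for hscale :: "complex \<Rightarrow> 'h::ab_group_add \<Rightarrow> 'h"
    and gscale :: "complex \<Rightarrow> 'g::ab_group_add \<Rightarrow> 'g"
    and gr :: "bit \<Rightarrow> 'g set" and br :: "'g \<Rightarrow> 'g \<Rightarrow> 'g"
    and H :: "'h \<Rightarrow> 'g"
    and q :: "'n::finite \<Rightarrow> bit" and h :: "'n \<Rightarrow> 'h" and a :: "'n \<Rightarrow> 'h \<Rightarrow> complex"
    and X Y :: "'n \<Rightarrow> 'g"
    and vscale :: "complex \<Rightarrow> 'v::ab_group_add \<Rightarrow> 'v"
    and vgr :: "bit \<Rightarrow> 'v set" and act :: "'g \<Rightarrow> 'v \<Rightarrow> 'v" +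
  fixes e u v :: 'n and \<beta> :: complex and lam :: "'h \<Rightarrow> complex" and w0 :: 'v
  assumes type: "S12_type q h a e u v \<beta>"
    and normalized: "a e (h e) = 2" "a v (h u) = 1" "a u (h v) = 1"
    and hw: "hw_vector w0 lam"
begin

abbreviation "integrable_S12 \<equiv> integrable_module gscale gr br H q h a vscale act"

lemma idx: "e \<noteq> u" "e \<noteq> v" "u \<noteq> v" "UNIV = {e, u, v}" "q e = 0" "q u = 1" "q v = 1"
    "a u (h e) = - 1" "a v (h e) = - 1" "a u (h u) = 0" "a e (h u) = \<beta> - 1"
    "a v (h v) = 0" "a e (h v) = - 1 - \<beta>"
  using type normalized unfolding S12_type_def by auto

lemma sum_idx: "(\<Sum>i\<in>UNIV. f i) = f e + f u + f v" for f :: "'n \<Rightarrow> complex"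
  unfolding idx(4) using idx(1-3) by (simp add: add.assoc)

text \<open>One vanishing generator makes all vanish, so there are no roots to test, and
  \<open>H (h i) = 0\<close> acts on \<open>w0\<close> by \<open>lam (h i)\<close>.\<close>

lemma degenerate:
  assumes "X k = 0 \<or> Y k = 0"
  shows "integrable_S12" "lam (h i) = 0"
proof -
  note zero = generators_zero[OF type assms]
  show "integrable_S12"
    using no_roots[OF zero(1,2)] hw_weight_module[OF hw] by (auto simp: integrable_module_def real_root_def)
  have "vscale (lam (h i)) w0 = act (H (h i)) w0" using hw by (simp add: hw_vector_def weight_space_def)
  then show "lam (h i) = 0" using hw by (simp add: zero(3) act_simps hw_vector_def)
qed

text \<open>The highest weight of the same module for the base reflected at
  \<open>u\<close>.\<close>

definition lam' :: "'h \<Rightarrow> complex" where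
  "lam' = (if lam (h u) = 0 then lam else (\<lambda>z. lam z - a u z))"

lemma nondegenerate:
  assumes nz: "\<And>i. X i \<noteq> 0" "\<And>i. Y i \<noteq> 0"
  shows "integrable_S12 \<longleftrightarrow> lam (h e) \<in> \<nat> \<and> lam' (h u + h v) \<in> \<nat>"
proof -
  have S: "S12_system hscale gscale gr br H q h a X Y e u v \<beta>"
    unfolding S12_system_def using type nz chev_system_axioms by blast
  note R = S12_system_odd_reflection[OF S]
  let ?h = "refl_coroot hscale a h u" and ?a = "refl_root a u"
  interpret R: chev_system hscale gscale gr br H "refl_par q u" ?h ?a "refl_X u" "refl_Y u"
    using R(1) by (simp add: S12_system_def)
  interpret R: irreducible_chev_module hscale gscale gr br H "refl_par q u" ?h ?a "refl_X u" "refl_Y u"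
    vscale vgr act
    by intro_locales (rule irreducible_chev_module_axioms[unfolded irreducible_chev_module_def, THEN conjunct2])
  have hv: "?h v = h u + h v"
    using idx normalized by (simp add: refl_coroot_def add.commute)
  have av: "?a v x = a v x + a u x" for x using idx by (simp add: refl_root_def)
  have add: "a i (h u + h v) = a i (h u) + a i (h v)" for i by (rule lin_add[OF a_linear])
  obtain w1 where w1: "R.hw_vector w1 lam'"
    using hw_odd_reflection[OF hw, of u e] idx unfolding R.hw_vector_def lam'_def by auto
  have even: "q e = 0" "a e (h e) = 2" "refl_par q u v = 0" "?a v (?h v) = 2"
    using idx normalized by (auto simp: refl_par_def hv av add)
  show ?thesis
  proof
    assume int: "integrable_S12"
    have nil: "\<exists>N. (act x ^^ N) y = 0"
      if "real_root gscale gr br H q h a \<gamma>" "x \<in> root_space gscale br H \<gamma>" for \<gamma> x y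
      using int that unfolding integrable_module_def by blast
    have r0: "reflected_base gscale gr br H q h a q h a" by (rule reflected_base.initial)
    have r1: "reflected_base gscale gr br H q h a (refl_par q u) ?h ?a"
      using reflected_base.odd[OF r0 idx(6,10), of "refl_par q u" ?h] R.base_datum by (simp add: R(2))
    obtain N where "(act (Y e) ^^ N) w0 = 0" using nil[OF real_root_minus[OF S r0] Y_root] by blast
    then have 1: "lam (h e) \<in> \<nat>"
      using singular_nilpotent[OF even(1,2), of w0 lam N] hw by (auto simp: hw_vector_def)
    obtain N where "(act (refl_Y u v) ^^ N) w1 = 0"
      using nil[OF R.real_root_minus[OF R(1) r1] R.Y_root] by blast
    then have "lam' (?h v) \<in> \<nat>"
      using R.singular_nilpotent[OF even(3,4), of w1 lam' N] w1 by (auto simp: R.hw_vector_def)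
    with 1 show "lam (h e) \<in> \<nat> \<and> lam' (h u + h v) \<in> \<nat>" by (simp add: hv)
  next
    assume dom: "lam (h e) \<in> \<nat> \<and> lam' (h u + h v) \<in> \<nat>"
    let ?P = "weights H vscale act"
    note wm = hw_weight_module[OF hw] and cone = hw_weights[OF hw]
    obtain m0 m1 where m: "lam (h e) = of_nat m0" "lam' (?h v) = of_nat m1"
      using dom unfolding hv by (metis Nats_cases)
    have nY: "locally_nilpotent (act (Y e))"
      by (rule Y_nilpotent[OF hw even(1,2) m(1)], rule serre_even_Y[OF even(1) S12_type_even_row[OF type]])
    have type': "S12_type (refl_par q u) ?h ?a v u e (\<beta> / (\<beta> - 1))" using R(1) by (simp add: S12_system_def)
    have nY': "locally_nilpotent (act (refl_Y u v))"
      by (rule R.Y_nilpotent[OF w1 even(3,4) m(2)], rule R.serre_even_Y[OF even(3) S12_type_even_row[OF type']])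
    have P0: "(\<lambda>z. \<phi> z - \<phi> (h e) * a e z) \<in> ?P" if "\<phi> \<in> ?P" for \<phi>
      by (rule weights_reflect[OF even(1,2) X_nilpotent[OF wm cone] nY that])
    have P1: "(\<lambda>z. \<phi> z - \<phi> (?h v) * ?a v z) \<in> ?P" if "\<phi> \<in> ?P" for \<phi>
      by (rule R.weights_reflect[OF even(3,4) R.X_nilpotent[OF wm R.hw_weights[OF w1]] nY' that])
    \<comment> \<open>The two even roots pair like the simple roots of affine \<open>sl(2)\<close>;
      their sum vanishes on both coroots.\<close>
    have pairing: "a e (?h v) = - 2" "?a v (h e) = - 2"
      using idx by (auto simp: hv av add)
    have "\<exists>N. (act x ^^ N) y = 0" if \<gamma>: "real_root gscale gr br H q h a \<gamma>" and x: "x \<in> root_space gscale br H \<gamma>" for \<gamma> x y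
    proof (rule nilpotent_weight_generated[OF wm])
      fix \<phi> w assume w: "w \<in> Wt \<phi>"
      obtain c where c: "\<And>x. \<gamma> x = (\<Sum>j\<in>UNIV. of_int (c j) * a j x)" and "\<gamma> (h e) \<noteq> 0"
        by (rule real_root_S12[OF \<gamma> S even(2)]) auto
      define t where "t = 2 * c e - c u - c v"
      have t: "\<gamma> (h e) = of_int t" "\<gamma> (?h v) = - of_int t"
        by (simp_all add: c sum_idx t_def hv add idx(5-) normalized algebra_simps)
      show "\<exists>N. (act x ^^ N) w = 0"
      proof (rule ccontr)
        assume "\<not> ?thesis"
        \<comment> \<open>If no power kills \<open>w\<close>, the whole string in direction \<gamma>
          consists of weights.\<close>
        then have P: "(\<lambda>z. \<phi> z + of_nat N * \<gamma> z) \<in> ?P" for N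
          using act_pow_weight[OF x w, of N] by (auto simp: weights_def)
        \<comment> \<open>The sign of \<open>t\<close> decides the order of the two reflections, so
          that the translation is positive; \<open>s\<close> is the absolute value of
          \<open>t\<close>.\<close>
        have "\<exists>s>0. \<forall>m. \<exists>\<psi>. \<forall>N. (\<lambda>z. \<psi> z + of_nat N * (\<gamma> z + of_nat m * of_int s * (a e z + a u z + a v z))) \<in> ?P"
        proof (cases "t > 0")
          case True
          show ?thesis
            using translate_weights[where P="?P" and ?c0.0="?h v" and ?b0.0="?a v" and ?c1.0="h e" and ?b1.0="a e" and \<beta>=\<gamma>,
                OF P1 P0 even(4,2) pairing(2,1) _ P] True
            by (intro exI[of _ t]) (simp add: t av ac_simps)
        next
          case False
          then have "- t > 0" using t(1) \<open>\<gamma> (h e) \<noteq> 0\<close> by (cases "t = 0") auto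
          then show ?thesis
            using translate_weights[where P="?P" and ?c1.0="?h v" and ?b1.0="?a v" and ?c0.0="h e" and ?b0.0="a e" and \<beta>=\<gamma>,
                OF P0 P1 even(2,4) pairing(1,2) _ P]
            by (intro exI[of _ "- t"]) (simp add: t av ac_simps)
        qed
        then obtain s where s: "s > 0"
          "\<And>m. \<exists>\<psi>. \<forall>N. (\<lambda>z. \<psi> z + of_nat N * (\<gamma> z + of_nat m * of_int s * (a e z + a u z + a v z))) \<in> ?P"
          by blast
        \<comment> \<open>Since \<open>s\<close> is at least 1, this makes the coefficient of
          \<open>a e\<close> positive, against \<open>weight_cone_bounded\<close>.\<close>
        define m where "m = nat \<bar>c e\<bar> + 1"
        obtain \<psi> where \<psi>: "\<And>N. (\<lambda>z. \<psi> z + of_nat N * (\<gamma> z + of_nat m * of_int s * (a e z + a u z + a v z))) \<in> ?P"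
          using s(2)[of m] by blast
        have "\<gamma> z + of_nat m * of_int s * (a e z + a u z + a v z) = (\<Sum>i\<in>UNIV. of_int (c i + int m * s) * a i z)" for z
          by (simp add: c sum_idx algebra_simps)
        moreover have "c e + int m * s > 0"
        proof -
          have "int m * 1 \<le> int m * s" using s(1) by (intro mult_left_mono) auto
          then show ?thesis by (simp add: m_def)
        qed
        ultimately obtain N where
          "(\<lambda>z. \<psi> z + of_nat N * (\<gamma> z + of_nat m * of_int s * (a e z + a u z + a v z))) \<notin> weight_cone a lam"
          using weight_cone_bounded[where c="\<lambda>i. of_int (c i + int m * s)" and k=e and z="c e + int m * s" and \<psi>=\<psi> and \<mu>=lam
              and \<beta>="\<lambda>z. \<gamma> z + of_nat m * of_int s * (a e z + a u z + a v z)"] by blast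
        then show False using \<psi>[of N] cone by blast
      qed
    qed
    then show "integrable_S12" unfolding integrable_module_def using wm by blast
  qed
qed

end

theorem lemma4p10:
  fixes \<alpha> :: complex
    and hscale :: "complex \<Rightarrow> 'h::ab_group_add \<Rightarrow> 'h"
    and hc :: "3 \<Rightarrow> 'h" and rt :: "3 \<Rightarrow> 'h \<Rightarrow> complex"
    and gscale :: "complex \<Rightarrow> 'g::ab_group_add \<Rightarrow> 'g"
    and gr :: "bit \<Rightarrow> 'g set" and br :: "'g \<Rightarrow> 'g \<Rightarrow> 'g"
    and H :: "'h \<Rightarrow> 'g" and X Y :: "3 \<Rightarrow> 'g"
    and vscale :: "complex \<Rightarrow> 'v::ab_group_add \<Rightarrow> 'v"
    and vgr :: "bit \<Rightarrow> 'v set" and act :: "'g \<Rightarrow> 'v \<Rightarrow> 'v"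
    and lam :: "'h \<Rightarrow> complex"
  assumes "\<alpha> \<noteq> 0" and "1 / \<alpha> \<notin> \<int>"
    and "contragredient hscale (S12_matrix \<alpha>) hc rt gscale gr br S12_parity H X Y"
    and "irreducible_highest_weight_module hscale gscale gr br H X vscale vgr act lam"
  shows "(lam (hc 2) \<noteq> 0 \<or> lam (hc 3) \<noteq> 0 \<longrightarrow>
            (integrable_module gscale gr br H S12_parity hc rt vscale act \<longleftrightarrow>
               lam (hc 1) \<in> \<nat> \<and> lam (hc 2) + lam (hc 3) - 1 \<in> \<nat>)) \<and>
         (lam (hc 2) = 0 \<and> lam (hc 3) = 0 \<longrightarrow>
            (integrable_module gscale gr br H S12_parity hc rt vscale act \<longleftrightarrow>
               lam (hc 1) \<in> \<nat>))"
proof -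
  interpret C: contragredient hscale "S12_matrix \<alpha>" hc rt gscale gr br S12_parity H X Y by fact
  interpret M: irreducible_highest_weight_module hscale gscale gr br H X vscale vgr act lam by fact
  interpret chev_system hscale gscale gr br H S12_parity hc rt X Y by (rule C.chev_system)
  have entries: "rt j (hc i) = S12_matrix \<alpha> $ i $ j" for i j by (rule C.rt_hc)
  note mat = entries S12_matrix_def vector_3
  have type: "S12_type S12_parity hc rt 1 2 3 \<alpha>"
    using assms(1,2) UNIV_3 by (simp add: S12_type_def S12_parity_def mat)
  from M.highest_weight_vector obtain w0 where w0: "w0 \<noteq> 0"
    "\<forall>x\<in>generated_subalgebra gscale br (range X). act x w0 = 0"
    "\<forall>x. act (H x) w0 = vscale (lam x) w0"
    by (elim exE conjE)
  interpret irreducible_chev_module hscale gscale gr br H S12_parity hc rt X Y vscale vgr act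
    by intro_locales (rule irreducible_chev_module_axioms.intro, rule M.irreducible)
  have hw: "hw_vector w0 lam"
    using w0 by (auto simp: hw_vector_def weight_space_def C.g.generated_base)
  interpret S12_module hscale gscale gr br H S12_parity hc rt X Y vscale vgr act 1 2 3 \<alpha> lam w0
    by (intro S12_module.intro S12_module_axioms.intro irreducible_chev_module_axioms type hw)
      (simp_all add: mat)
  show ?thesis
  proof (cases "\<exists>k. X k = 0 \<or> Y k = 0")
    case True
    \<comment> \<open>Here \<open>lam\<close> vanishes on every \<open>hc i\<close>, so only the
      second claim applies, and both its sides hold.\<close>
    then have "integrable_S12" "\<And>i. lam (hc i) = 0" using degenerate by blast+
    then show ?thesis by simp
  next
    case False
    then have iff: "integrable_S12 \<longleftrightarrow> lam (hc 1) \<in> \<nat> \<and> lam' (hc 2 + hc 3) \<in> \<nat>"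
      using nondegenerate by blast
    have lam': "lam' (hc 2 + hc 3) = (if lam (hc 2) = 0 then lam (hc 3) else lam (hc 2) + lam (hc 3) - 1)"
      by (simp add: lam'_def lin_add[OF M.weight_linear] lin_add[OF a_linear] mat)
    \<comment> \<open>If \<open>lam (hc 2) = 0\<close>, the criterion speaks of
      \<open>lam (hc 3)\<close>; for a nonzero value this agrees with the condition on
      \<open>lam (hc 3) - 1\<close>.\<close>
    have "lam (hc 3) \<in> \<nat> \<longleftrightarrow> lam (hc 3) - 1 \<in> \<nat>" if "lam (hc 3) \<noteq> 0"
    proof
      assume "lam (hc 3) \<in> \<nat>"
      then obtain n where "lam (hc 3) = of_nat n" by (rule Nats_cases)
      with that show "lam (hc 3) - 1 \<in> \<nat>" by (cases n) auto
    next
      assume "lam (hc 3) - 1 \<in> \<nat>"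
      from Nats_add[OF this Nats_1] show "lam (hc 3) \<in> \<nat>" by simp
    qed
    then show ?thesis unfolding iff lam' by auto
  qed
qed

end
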